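(* Let $L$ be a virtual singular link with $k$ components, and let $D$ be any oriented diagram of $L$. Then $R(L)=R(D)=\phi(D)h+\psi(D)$ with $\phi(D)\in\mathbb{Z}[A^4,A^{-4}]\cdot A^{2(k-1)}$ and $\psi(D)\in\mathbb{Z}[A^4,A^{-4}]\cdot A^{2k}$.
   Context: An oriented virtual singular link diagram is a generic immersion of finitely many oriented circles (its components) into $\mathbb{R}^2$ with finitely many transverse double points, each decorated as a classical crossing (with over/under information and the usual sign $\pm1$), a singular crossing, or a virtual crossing; a virtual singular link is an equivalence class of such diagrams under planar isotopy and the extended Reidemeister moves (classical $R_1,R_2,R_3$; sliding a strand entirely over/under a singular crossing; moving a classical crossing between the same two strands to the other side of a singular crossing; virtual $V_1,V_2,V_{3}$; sliding a strand with two consecutive virtual crossings across a classical or a singular crossing). At a classical or singular crossing, the oriented resolution replaces it by two disjoint arcs respecting orientation; the disoriented resolution replaces it by one arc joining the two incoming ends with a sink bivalent vertex and one arc joining the two outgoing ends with a source bivalent vertex. Virtual crossings are kept. A state $S$ of $D$ is a choice of resolution at every classical and singular crossing; it is a collection of immersed closed curves (all intersections virtual) carrying bivalent vertices with edge orientations alternating. $\|S\|$ = number of closed curves; $c(D)$ = number of classical crossings; $a(S)$ = #(negative classical crossings with oriented resolution) $-$ #(positive classical crossings with oriented resolution); $b(S)$ the same for disoriented resolutions; $\alpha(S),\beta(S)$ = numbers of singular crossings with oriented, resp. disoriented, resolution. An edge of $S$ is an arc between consecutive bivalent vertices (a closed curve without vertices is one edge). A weight map is $\tau:E(S)\to\{\pm1\}$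 with different values on edges sharing a vertex; for a virtual crossing $v$ where edges $e,e'$ meet (possibly $e=e'$), $i_\tau(v)=\tau(e)\tau(e')$, and $i(S)=\prod_v i_\tau(v)$ (independent of $\tau$). Let $\overline{R}(S)=A^{2a(S)+4b(S)}(-A^2-A^{-2})^{\alpha(S)+\|S\|}(-A^4-A^{-4})^{\beta(S)}$, $R(D)=(-1)^{c(D)}\sum_S\overline{R}(S)h^{\frac{1-i(S)}{2}}$, $\phi(D)=(-1)^{c(D)}\sum_{S:\,i(S)=-1}\overline{R}(S)$, $\psi(D)=(-1)^{c(D)}\sum_{S:\,i(S)=1}\overline{R}(S)$. $R(D)$ depends only on the link $L$ represented by $D$, and $R(L):=R(D)$. *)

theory Defs
  imports "HOL-Computational_Algebra.Formal_Laurent_Series" "HOL-Computational_Algebra.Polynomial"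
begin

section \<open>Combinatorial model of oriented virtual singular link diagrams\<close>

text \<open>
Crossings are numbered 0..<n. Every crossing (classical, singular or virtual) has four
ports (c,0),(c,1),(c,2),(c,3) in counterclockwise cyclic order. The two strands pass
straight through: one enters at port 0 and leaves at port 2, the other enters at port 1
and leaves at port 3 (so ports 0,1 are incoming, 2,3 outgoing; with port 0 = SW,
1 = SE, 2 = NE, 3 = NW when both strands point upwards).
For a classical crossing, Classical True means the strand 0->2 is the over strand,
which is the positive crossing (sign +1); Classical False means the strand 1->3 is over
(sign -1).
The field nxt maps every outgoing port p to the incoming port where the arc of the
diagram starting at p ends. ncirc counts the closed components without any crossing.
\<close>

datatype ctype = Classical bool | Singular | Virtual

record vsdiag =
  ncr   :: nat
  ctyp  :: "nat \<Rightarrow> ctype"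
  nxt   :: "nat \<times> nat \<Rightarrow> nat \<times> nat"
  ncirc :: nat

definition outs :: "vsdiag \<Rightarrow> (nat \<times> nat) set" where
  "outs D = {(c, j). c < ncr D \<and> (j = 2 \<or> j = 3)}"

definition ins :: "vsdiag \<Rightarrow> (nat \<times> nat) set" where
  "ins D = {(c, j). c < ncr D \<and> (j = 0 \<or> j = 1)}"

definition ports :: "vsdiag \<Rightarrow> (nat \<times> nat) set" where
  "ports D = {(c, j). c < ncr D \<and> j < 4}"

text \<open>The arc of the diagram arriving at the incoming port q (identified by its starting port).\<close>
definition arcIn :: "vsdiag \<Rightarrow> nat \<times> nat \<Rightarrow> nat \<times> nat" where
  "arcIn D q = inv_into (outs D) (nxt D) q"

text \<open>Number of classes of the equivalence relation on X generated by R.\<close>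
definition ncomp :: "'a set \<Rightarrow> ('a \<times> 'a) set \<Rightarrow> nat" where
  "ncomp X R = card (X // ((Restr (R \<union> R\<inverse>) X)\<^sup>*))"

text \<open>Edge involution on darts (ports) and counterclockwise rotation at a crossing.\<close>
definition alpha :: "vsdiag \<Rightarrow> nat \<times> nat \<Rightarrow> nat \<times> nat" where
  "alpha D d = (if d \<in> outs D then nxt D d else arcIn D d)"

definition rot :: "nat \<times> nat \<Rightarrow> nat \<times> nat" where
  "rot d = (fst d, (snd d + 1) mod 4)"

definition nfaces :: "vsdiag \<Rightarrow> nat" where
  "nfaces D = ncomp (ports D) {(d, rot (alpha D d)) | d. d \<in> ports D}"

definition ngraphcomp :: "vsdiag \<Rightarrow> nat" where
  "ngraphcomp D = ncomp {..<ncr D} {(fst p, fst (nxt D p)) | p. p \<in> outs D}"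

text \<open>Well-formedness: nxt is a bijection outgoing ports -> incoming ports, and the
4-valent graph with this rotation system is planar (Euler: every connected component
with V vertices and 2V edges has V + 2 faces).\<close>
definition wf_diag :: "vsdiag \<Rightarrow> bool" where
  "wf_diag D \<longleftrightarrow> bij_betw (nxt D) (outs D) (ins D)
     \<and> nfaces D = ncr D + 2 * ngraphcomp D"

definition ccross :: "vsdiag \<Rightarrow> nat set" where
  "ccross D = {c. c < ncr D \<and> (\<exists>b. ctyp D c = Classical b)}"

definition scross :: "vsdiag \<Rightarrow> nat set" where
  "scross D = {c. c < ncr D \<and> ctyp D c = Singular}"

definition pos_cross :: "vsdiag \<Rightarrow> nat set" where
  "pos_cross D = {c. c < ncr D \<and> ctyp D c = Classical True}"

definition neg_cross :: "vsdiag \<Rightarrow> nat set" where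
  "neg_cross D = {c. c < ncr D \<and> ctyp D c = Classical False}"

definition vcross :: "vsdiag \<Rightarrow> nat set" where
  "vcross D = {c. c < ncr D \<and> ctyp D c = Virtual}"

text \<open>Number of components of the diagram (strands go straight through every crossing).\<close>
definition ncomponents :: "vsdiag \<Rightarrow> nat" where
  "ncomponents D = ncomp (outs D)
      {(p, q). p \<in> outs D \<and> q = (fst (nxt D p), snd (nxt D p) + 2)} + ncirc D"

section \<open>States\<close>

text \<open>A state is given by the set T of classical/singular crossings that receive the
disoriented resolution (all others in ccross D \<union> scross D get the oriented one).
Oriented resolution: incoming 0 is joined to outgoing 3, incoming 1 to outgoing 2.
Disoriented: incoming 0,1 joined (sink vertex), outgoing 2,3 joined (source vertex).
Virtual crossings: 0 continues to 2, 1 to 3.\<close>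

definition states :: "vsdiag \<Rightarrow> nat set set" where
  "states D = Pow (ccross D \<union> scross D)"

definition through :: "vsdiag \<Rightarrow> nat \<Rightarrow> nat \<Rightarrow> nat" where
  "through D c i = (if ctyp D c = Virtual then i + 2 else (if i = 0 then 3 else 2))"

text \<open>Continuation without vertex (same edge of the state).\<close>
definition edgeRel :: "vsdiag \<Rightarrow> nat set \<Rightarrow> ((nat \<times> nat) \<times> (nat \<times> nat)) set" where
  "edgeRel D T = {(p, q). p \<in> outs D \<and> fst (nxt D p) \<notin> T
        \<and> q = (fst (nxt D p), through D (fst (nxt D p)) (snd (nxt D p)))}"

text \<open>Pairs of arcs meeting at a bivalent vertex.\<close>
definition vertRel :: "vsdiag \<Rightarrow> nat set \<Rightarrow> ((nat \<times> nat) \<times> (nat \<times> nat)) set" where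
  "vertRel D T = {(arcIn D (c, 0), arcIn D (c, 1)) | c. c \<in> T} \<union> {((c, 2), (c, 3)) | c. c \<in> T}"

definition ncurves :: "vsdiag \<Rightarrow> nat set \<Rightarrow> nat" where
  "ncurves D T = ncomp (outs D) (edgeRel D T \<union> vertRel D T) + ncirc D"

text \<open>Weight maps (on arcs; constant along edges, different across vertices).\<close>
definition weight_map :: "vsdiag \<Rightarrow> nat set \<Rightarrow> (nat \<times> nat \<Rightarrow> int) \<Rightarrow> bool" where
  "weight_map D T \<tau> \<longleftrightarrow> (\<forall>p \<in> outs D. \<tau> p = 1 \<or> \<tau> p = -1)
     \<and> (\<forall>(p, q) \<in> edgeRel D T. \<tau> p = \<tau> q)
     \<and> (\<forall>(p, q) \<in> vertRel D T. \<tau> p \<noteq> \<tau> q)"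

definition iS :: "vsdiag \<Rightarrow> nat set \<Rightarrow> int" where
  "iS D T = (let \<tau> = (SOME \<tau>. weight_map D T \<tau>) in
      (\<Prod>c \<in> vcross D. \<tau> (arcIn D (c, 0)) * \<tau> (arcIn D (c, 1))))"

definition aS :: "vsdiag \<Rightarrow> nat set \<Rightarrow> int" where
  "aS D T = int (card (neg_cross D - T)) - int (card (pos_cross D - T))"

definition bS :: "vsdiag \<Rightarrow> nat set \<Rightarrow> int" where
  "bS D T = int (card (neg_cross D \<inter> T)) - int (card (pos_cross D \<inter> T))"

definition alphaS :: "vsdiag \<Rightarrow> nat set \<Rightarrow> nat" where
  "alphaS D T = card (scross D - T)"

definition betaS :: "vsdiag \<Rightarrow> nat set \<Rightarrow> nat" where
  "betaS D T = card (scross D \<inter> T)"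

section \<open>Laurent polynomials in A\<close>

text \<open>A^m for integer m, as a formal Laurent series (A = fls_X).\<close>
definition Apow :: "int \<Rightarrow> int fls" where
  "Apow m = (if 0 \<le> m then fls_X ^ nat m else fls_X_inv ^ nat (- m))"

definition Rbar :: "vsdiag \<Rightarrow> nat set \<Rightarrow> int fls" where
  "Rbar D T = Apow (2 * aS D T + 4 * bS D T)
     * (- Apow 2 - Apow (-2)) ^ (alphaS D T + ncurves D T)
     * (- Apow 4 - Apow (-4)) ^ betaS D T"

text \<open>R(D) as a polynomial in h with Laurent-polynomial coefficients.\<close>
definition Rinv :: "vsdiag \<Rightarrow> int fls poly" where
  "Rinv D = (-1) ^ card (ccross D) *
     (\<Sum>T \<in> states D. [:Rbar D T:] * [:0, 1:] ^ nat ((1 - iS D T) div 2))"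

definition phi :: "vsdiag \<Rightarrow> int fls" where
  "phi D = (-1) ^ card (ccross D) * (\<Sum>T \<in> {T \<in> states D. iS D T = -1}. Rbar D T)"

definition psi :: "vsdiag \<Rightarrow> int fls" where
  "psi D = (-1) ^ card (ccross D) * (\<Sum>T \<in> {T \<in> states D. iS D T = 1}. Rbar D T)"

text \<open>f \<in> Z[A^4, A^-4] * A^m.\<close>
definition in_ZA4_times :: "int \<Rightarrow> int fls \<Rightarrow> bool" where
  "in_ZA4_times m f \<longleftrightarrow> (\<exists>g. finite {n. fls_nth g n \<noteq> 0} \<and> (\<forall>n. fls_nth g n \<noteq> 0 \<longrightarrow> 4 dvd n)
      \<and> f = g * Apow m)"

end

theory Submission
  imports Defs "HOL-Combinatorics.Permutations"
begin

text \<open>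
For a state \<open>S\<close> with \<open>o(S)\<close> oriented resolutions, the exponents of \<open>A\<close> in the summand of \<open>S\<close>
are congruent to \<open>2 (o(S) + ||S||)\<close> modulo 4, so everything reduces to the identity
\<open>i(S) = (-1)^(o(S) + ||S|| + k)\<close>.

Fix a weight map and traverse the arcs of weight \<open>-1\<close> backwards. At every crossing exactly two of
the three ways to join the four ports respect the traversal, and exchanging them composes the
successor permutation of the arcs with a transposition, hence changes the number of loops by an odd
number. From the straight resolution, which has \<open>k\<close> loops, one reaches \<open>S\<close> in two stages: in the
traversal along the diagram, turn all classical and singular crossings into oriented resolutions
except the disoriented ones that are transverse, i.e. where two straight strands of opposite weights
would cross; then, in the traversal given by the weights, switch every disoriented crossing. This
gives \<open>o(S) + ||S|| + k\<close> modulo 2 as the number of transverse disoriented crossings. As \<open>i(S)\<close> counts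
the transverse virtual crossings, it remains to see that the total number of transverse crossings
is even. This is where planarity enters: by Euler's formula and a dimension count over the field with
two elements, the arcs of weight \<open>-1\<close> bound a set of faces, and the arcs of weight \<open>1\<close> switch
between this set and its complement exactly at the transverse crossings.
\<close>

section \<open>Orbits, transpositions and involutions\<close>

abbreviation conn :: "'a set \<Rightarrow> ('a \<times> 'a) set \<Rightarrow> ('a \<times> 'a) set" where
  "conn X R \<equiv> (Restr (R \<union> R\<inverse>) X)\<^sup>*"

lemma equiv_conn: "equiv UNIV (conn X R)"
proof -
  have "sym (Restr (R \<union> R\<inverse>) X)"
    by (auto simp: sym_def)
  then show ?thesis
    by (intro equivI) (auto simp: sym_rtrancl trans_rtrancl refl_rtrancl)
qed

lemma conn_sym: "(x, y) \<in> conn X R \<Longrightarrow> (y, x) \<in> conn X R"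
proof -
  assume "(x, y) \<in> conn X R"
  moreover have "sym (conn X R)" using equiv_conn by (rule equivE)
  ultimately show "(y, x) \<in> conn X R" by (rule symD[rotated])
qed

lemma conn_edge: "(x, y) \<in> R \<Longrightarrow> x \<in> X \<Longrightarrow> y \<in> X \<Longrightarrow> (x, y) \<in> conn X R"
  by blast

lemma conn_class_eq: "conn X R `` {x} = conn X R `` {y} \<longleftrightarrow> (x, y) \<in> conn X R"
  by (rule eq_equiv_class_iff[OF equiv_conn UNIV_I UNIV_I])

lemma conn_map:
  assumes "(x, y) \<in> conn X R"
    and "\<And>a b. (a, b) \<in> R \<Longrightarrow> a \<in> X \<Longrightarrow> b \<in> X \<Longrightarrow> (f a, f b) \<in> conn Y S"
  shows "(f x, f y) \<in> conn Y S"
  using assms(1)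
proof (induction rule: rtrancl_induct)
  case (step b c)
  then have "(f b, f c) \<in> conn Y S"
    using assms(2)[of b c] conn_sym[OF assms(2)[of c b]] by blast
  with step.IH show ?case by (rule rtrancl_trans)
qed simp

text \<open>The map \<open>g\<close> descends to a map from the classes of \<open>S\<close> to the
  classes of \<open>R\<close>, and this map is onto because \<open>g\<close> sends
  \<open>f x\<close> back into the class of \<open>x\<close>.\<close>

lemma ncomp_le:
  assumes "finite Y"
    and "\<And>x. x \<in> X \<Longrightarrow> f x \<in> Y"
    and "\<And>x. x \<in> X \<Longrightarrow> (g (f x), x) \<in> conn X R"
    and "\<And>a b. (a, b) \<in> S \<Longrightarrow> a \<in> Y \<Longrightarrow> b \<in> Y \<Longrightarrow> (g a, g b) \<in> conn X R"
  shows "ncomp X R \<le> ncomp Y S"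
proof -
  let ?h = "\<lambda>C. conn X R `` {g (SOME y. y \<in> C)}"
  have "X // conn X R \<subseteq> ?h ` (Y // conn Y S)"
  proof
    fix C assume "C \<in> X // conn X R"
    then obtain x where x: "x \<in> X" "C = conn X R `` {x}" by (auto elim: quotientE)
    let ?B = "conn Y S `` {f x}"
    have "(SOME y. y \<in> ?B) \<in> ?B" by (rule someI[of _ "f x"]) simp
    then have "(f x, SOME y. y \<in> ?B) \<in> conn Y S" by simp
    then have "(g (f x), g (SOME y. y \<in> ?B)) \<in> conn X R"
      using conn_map[where f = g] assms(4) by blast
    with assms(3)[OF x(1)] have "(x, g (SOME y. y \<in> ?B)) \<in> conn X R"
      by (rule rtrancl_trans[OF conn_sym])
    then have "C = ?h ?B" unfolding x(2) by (simp only: conn_class_eq)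
    moreover have "?B \<in> Y // conn Y S" using assms(2)[OF x(1)] by (rule quotientI)
    ultimately show "C \<in> ?h ` (Y // conn Y S)" by blast
  qed
  moreover have "finite (Y // conn Y S)"
    using assms(1) by (simp add: quotient_def)
  ultimately show ?thesis unfolding ncomp_def by (rule surj_card_le[rotated])
qed

text \<open>The only new generator is the pair \<open>(x, x)\<close>, already present in the
  reflexive closure; so \<open>{x}\<close> becomes a class of its own beside the classes inside
  \<open>X\<close>.\<close>

lemma ncomp_insert_isolated:
  assumes "finite X" "x \<notin> X" "p ` X \<subseteq> X" "p x = x"
  shows "ncomp (insert x X) {(y, p y) | y. y \<in> insert x X} = Suc (ncomp X {(y, p y) | y. y \<in> X})"
proof -
  let ?R = "{(y, p y) | y. y \<in> insert x X}" and ?S = "{(y, p y) | y. y \<in> X}"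
  have "Restr (?R \<union> ?R\<inverse>) (insert x X) = insert (x, x) (Restr (?S \<union> ?S\<inverse>) X)"
    using assms by auto
  then have eq: "conn (insert x X) ?R = conn X ?S"
    using rtrancl_subset[of "Restr (?S \<union> ?S\<inverse>) X" "insert (x, x) (Restr (?S \<union> ?S\<inverse>) X)"]
    by auto
  have cx: "conn X ?S `` {x} = {x}"
    using assms(2) by (auto elim: converse_rtranclE)
  have "X // conn X ?S \<subseteq> Pow X"
    by (auto simp: quotient_def elim: rtranclE)
  then have "{x} \<notin> X // conn X ?S" using assms(2) by blast
  moreover have "insert x X // conn X ?S = insert {x} (X // conn X ?S)"
    using cx by (auto simp: quotient_def)
  ultimately show ?thesis
    unfolding ncomp_def eq using assms(1) by (simp add: quotient_def)
qed

text \<open>Cutting \<open>x\<close> out of its cycle multiplies \<open>p\<close> by a transposition and keeps the orbits.\<close>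
lemma sign_ncomp:
  assumes "finite X" "p permutes X"
  shows "sign p = (-1) ^ (card X + ncomp X {(x, p x) | x. x \<in> X})"
  using assms
proof (induction X arbitrary: p rule: finite_induct)
  case empty
  then show ?case by (simp add: ncomp_def quotient_def)
next
  case (insert x X)
  let ?q = "transpose x (p x) \<circ> p"
  have q: "?q permutes X"
    using permutes_insert_lemma[OF insert.prems] by simp
  show ?case
  proof (cases "p x = x")
    case True
    then have "p permutes X" using q by simp
    moreover from this have "p ` X \<subseteq> X" by (simp add: permutes_image)
    ultimately show ?thesis
      using insert.IH[of p] insert.hyps True by (simp add: ncomp_insert_isolated del: insert_iff)
  next
    case False
    have perm: "permutation p" using insert.prems insert.hyps(1)
      by (auto simp: permutation_permutes)
    have s: "sign ?q = - sign p"
      using False perm by (simp add: sign_compose permutation_swap_id sign_swap_id)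
    let ?R = "{(y, p y) | y. y \<in> insert x X}" and ?S = "{(y, ?q y) | y. y \<in> X}"
    have pin: "p y \<in> insert x X" if "y \<in> insert x X" for y
      using that by (simp only: permutes_in_image[OF insert.prems])
    have inj: "p y = p z \<longleftrightarrow> y = z" for y z
      using insert.prems by (metis permutes_inj injD)
    have px: "p x \<in> X" using pin[of x] False by simp
    \<comment> \<open>The predecessor of \<open>x\<close> is redirected to the successor of
      \<open>x\<close>; all other values are those of \<open>p\<close>.\<close>
    have q1: "?q y = (if p y = x then p x else p y)" if "y \<in> X" for y
      using that insert.hyps(2) inj[of y x] by (auto simp: transpose_def)
    have qX: "?q y \<in> X" if "y \<in> X" for y using that q permutes_in_image by metis
    have "ncomp (insert x X) ?R \<le> ncomp X ?S"
    \<comment> \<open>Since \<open>x\<close> is missing from \<open>X\<close>, its successor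
      \<open>p x\<close>, which lies on the same cycle, stands in for it; the same map serves in the
      converse inequality.\<close>
    proof (rule ncomp_le[where f = "\<lambda>y. if y = x then p x else y" and g = id])
      fix y assume "y \<in> insert x X"
      moreover have "(p x, x) \<in> conn (insert x X) ?R"
        using px by (intro conn_sym[OF conn_edge]) auto
      ultimately show "(id (if y = x then p x else y), y) \<in> conn (insert x X) ?R" by auto
    next
      fix a b assume ab: "(a, b) \<in> ?S" "a \<in> X" "b \<in> X"
      then have b: "b = (if p a = x then p x else p a)" using q1 by auto
      have 1: "(a, p a) \<in> conn (insert x X) ?R"
        using ab pin[of a] by (intro conn_edge) auto
      have 2: "(x, p x) \<in> conn (insert x X) ?R"
        using px by (intro conn_edge) auto
      show "(id a, id b) \<in> conn (insert x X) ?R"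
        using b 1 2 by (auto intro: rtrancl_trans split: if_splits)
    qed (use insert.hyps px in auto)
    moreover have "ncomp X ?S \<le> ncomp (insert x X) ?R"
    proof (rule ncomp_le[where g = "\<lambda>y. if y = x then p x else y" and f = id])
      fix a b assume ab: "(a, b) \<in> ?R" "a \<in> insert x X" "b \<in> insert x X"
      then have b: "b = p a" by auto
      show "(if a = x then p x else a, if b = x then p x else b) \<in> conn X ?S"
      proof (cases "a = x")
        case True
        then show ?thesis using b False by simp
      next
        case aX: False
        then have "a \<in> X" using ab by simp
        then have "(a, ?q a) \<in> conn X ?S" using qX by (intro conn_edge) blast+
        then have "(a, if p a = x then p x else p a) \<in> conn X ?S"
            unfolding q1[OF \<open>a \<in> X\<close>] .
          then show ?thesis using aX b by (cases "p a = x") simp_all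
      qed
    qed (use insert.hyps in auto)
    ultimately show ?thesis
      using insert.IH[OF q] s insert.hyps by (simp del: o_apply)
  qed
qed

text \<open>A transposition flips the sign, while \<open>sign_ncomp\<close> reads the sign off the
  number of orbits and the fixed cardinality of \<open>X\<close>.\<close>

lemma ncomp_transpose:
  assumes "finite X" "p permutes X" "a \<in> X" "b \<in> X" "a \<noteq> b"
  shows "even (ncomp X {(x, (p \<circ> transpose a b) x) | x. x \<in> X})
     \<longleftrightarrow> odd (ncomp X {(x, p x) | x. x \<in> X})"
proof -
  have "permutation p" using assms by (auto simp: permutation_permutes)
  then have "sign (p \<circ> transpose a b) = - sign p"
    using assms(5) by (simp add: sign_compose permutation_swap_id sign_swap_id)
  moreover have "(p \<circ> transpose a b) permutes X"
    using assms by (intro permutes_compose permutes_swap_id)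
  ultimately show ?thesis
    using sign_ncomp[OF assms(1,2)] sign_ncomp[OF assms(1), of "p \<circ> transpose a b"]
    by (auto simp: power_add minus_one_power_iff split: if_splits)
qed

text \<open>Deleting a pair \<open>{x, a x}\<close> and joining its two \<open>b\<close>-partners preserves the situation.\<close>
lemma two_colouring_involutions:
  assumes "finite P"
    and "\<And>x. x \<in> P \<Longrightarrow> a x \<in> P \<and> a x \<noteq> x \<and> a (a x) = x"
    and "\<And>x. x \<in> P \<Longrightarrow> b x \<in> P \<and> b x \<noteq> x \<and> b (b x) = x"
  shows "\<exists>u. \<forall>x\<in>P. u (a x) = (\<not> u x) \<and> u (b x) = (\<not> u x)"
  using assms
\<comment> \<open>Deleting a pair restricts \<open>a\<close> but rewires \<open>b\<close>, so
  \<open>b\<close> is generalised and \<open>a\<close> stays fixed.\<close>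
proof (induction "card P" arbitrary: P b rule: less_induct)
  case less
  note a = less.prems(2) and b = less.prems(3)
  show ?case
  proof (cases "P = {}")
    case False
    then obtain x where x: "x \<in> P" by blast
    let ?P = "P - {x, a x}"
    have lt: "card ?P < card P" using x less.prems(1) by (intro psubset_card_mono) auto
    have aP: "a y \<in> ?P \<and> a y \<noteq> y \<and> a (a y) = y" if "y \<in> ?P" for y
      using that a[of y] a[of x] x by (metis Diff_iff insert_iff singletonD)
    show ?thesis
    \<comment> \<open>If \<open>b x = a x\<close>, the pair is closed under both involutions and can
      be coloured on its own.\<close>
    proof (cases "b x = a x")
      case True
      have bP: "b y \<in> ?P \<and> b y \<noteq> y \<and> b (b y) = y" if "y \<in> ?P" for y
        using that b[of y] b[of x] x True by (metis Diff_iff insert_iff singletonD)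
      from less.hyps[OF lt _ aP bP] less.prems(1)
      obtain u where u: "\<forall>y\<in>?P. u (a y) = (\<not> u y) \<and> u (b y) = (\<not> u y)" by auto
      let ?u = "u(x := True, a x := False)"
      have "?u (a y) = (\<not> ?u y) \<and> ?u (b y) = (\<not> ?u y)" if y: "y \<in> P" for y
      proof (cases "y = x \<or> y = a x")
        case True
        have "a x \<noteq> x" "a (a x) = x" "b (a x) = x" using a[OF x] b[OF x] \<open>b x = a x\<close> by auto
        then show ?thesis using True \<open>b x = a x\<close> by auto
      next
        case False
        then have "y \<in> ?P" using y by blast
        then have "a y \<in> ?P" "b y \<in> ?P" "u (a y) = (\<not> u y)" "u (b y) = (\<not> u y)"
          using aP bP u by blast+
        then show ?thesis using False by simp
      qed
      then show ?thesis by blast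
    next
      case ne: False
      let ?b = "b(b x := b (a x), b (a x) := b x)"
      have ax: "a x \<in> P" "a x \<noteq> x" "a (a x) = x" using a x by auto
      have bx: "b x \<in> ?P" "b (a x) \<in> ?P" "b x \<noteq> b (a x)"
        using ax b[OF x] b[OF ax(1)] ne by (metis Diff_iff insert_iff singletonD)+
      have "?b y \<in> ?P \<and> ?b y \<noteq> y \<and> ?b (?b y) = y" if y: "y \<in> ?P" for y
      proof (cases "y = b x \<or> y = b (a x)")
        case True
        then show ?thesis using bx by auto
      next
        case False
        then have "b y \<noteq> x" "b y \<noteq> a x" "b y \<noteq> b x" "b y \<noteq> b (a x)"
          using b[of y] b[OF x] b[OF ax(1)] y by auto
        then show ?thesis using False b[of y] y by auto
      qed
      from less.hyps[OF lt _ aP this] less.prems(1)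
      obtain u where u: "\<forall>y\<in>?P. u (a y) = (\<not> u y) \<and> u (?b y) = (\<not> u y)" by auto
      \<comment> \<open>The colours of the deleted pair are forced by \<open>b\<close>; they are
        opposite because \<open>?b\<close> matches \<open>b x\<close> with
        \<open>b (a x)\<close>.\<close>
      let ?u = "u(x := \<not> u (b x), a x := \<not> u (b (a x)))"
      have bb: "u (b (a x)) = (\<not> u (b x))" using u bx by (metis fun_upd_apply)
      have "?u (a y) = (\<not> ?u y) \<and> ?u (b y) = (\<not> ?u y)" if y: "y \<in> P" for y
      proof (cases "y = x \<or> y = a x")
        case True
        then show ?thesis using ax bx bb by auto
      next
        case yP: False
        then have ay: "a y \<noteq> x" "a y \<noteq> a x" using a[of y] a[of x] x y ax by metis+
        have ua: "u (a y) = (\<not> u y)" using u y yP by blast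
        have ub: "?u (b y) = (\<not> u y)"
        proof (cases "y = b x \<or> y = b (a x)")
          case True
          then show ?thesis using b[OF x] b[OF ax(1)] ax(2) by auto
        next
          case False
          then have "b y \<noteq> x" "b y \<noteq> a x"
            using b[of y] b[OF x] b[OF ax(1)] y by auto
          then show ?thesis using u y yP False by (metis DiffI fun_upd_apply insertE singletonD)
        qed
        show ?thesis using ay ua ub yP by simp
      qed
      then show ?thesis by blast
    qed
  qed simp
qed

section \<open>Resolutions and their loops\<close>

lemma less4: "(j::nat) < 4 \<longleftrightarrow> j = 0 \<or> j = 1 \<or> j = 2 \<or> j = 3"
  by auto

lemma xor_partner:
  fixes j v :: nat
  assumes "j < 4" "v \<in> {1, 2, 3}"
  shows "xor j v < 4" "xor j v \<noteq> j" "xor (xor j v) v = j"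
  using assms unfolding less4 by auto

text \<open>For \<open>v\<close> = 1, 2, 3 the maps \<open>xor _ v\<close> are the three pairings of
  the four ports; with the identity they form the Klein four-group, so two different ones commute
  and together reach every port.\<close>

lemma xor_klein:
  fixes j v w :: nat
  assumes "j < 4" "v \<in> {1, 2, 3}" "w \<in> {1, 2, 3}" "v \<noteq> w"
  shows "xor (xor j v) w < 4" "xor (xor j v) w \<noteq> j" "xor (xor (xor j v) w) v = xor j w"
    and "xor (xor (xor j v) w) w = xor j v"
    and "i < 4 \<Longrightarrow> i = j \<or> i = xor j v \<or> i = xor j w \<or> i = xor (xor j v) w"
  using assms unfolding less4 by auto

section \<open>Ports, arcs and resolutions of a diagram\<close>

locale diagram =
  fixes D :: vsdiag
  assumes nxt_bij: "bij_betw (nxt D) (outs D) (ins D)"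
begin

lemma ports_eq: "ports D = outs D \<union> ins D"
  by (auto simp: ports_def outs_def ins_def)

lemma outs_ins_disjoint: "d \<in> outs D \<Longrightarrow> d \<notin> ins D"
  by (auto simp: outs_def ins_def)

lemma outs_times: "outs D = {..<ncr D} \<times> {2, 3}"
  by (auto simp: outs_def)

lemma finite_outs: "finite (outs D)"
  and card_outs: "card (outs D) = 2 * ncr D"
  by (simp_all add: outs_times card_cartesian_product)

lemma ports_times: "ports D = {..<ncr D} \<times> {..<4}"
  by (auto simp: ports_def)

lemma finite_ports: "finite (ports D)"
  by (simp add: ports_times)

lemma nxt_ins: "p \<in> outs D \<Longrightarrow> nxt D p \<in> ins D"
  using nxt_bij by (auto simp: bij_betw_def)

lemma arcIn_nxt: "p \<in> outs D \<Longrightarrow> arcIn D (nxt D p) = p"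
  unfolding arcIn_def using nxt_bij by (simp add: bij_betw_def)

lemma arcIn_outs: "q \<in> ins D \<Longrightarrow> arcIn D q \<in> outs D"
  and nxt_arcIn: "q \<in> ins D \<Longrightarrow> nxt D (arcIn D q) = q"
  unfolding arcIn_def using nxt_bij
  by (auto simp: bij_betw_def inv_into_into f_inv_into_f)

text \<open>An arc is named by its starting port, so both of its ends are sent to the same
  value.\<close>

definition arc :: "nat \<times> nat \<Rightarrow> nat \<times> nat" where
  "arc d = (if d \<in> outs D then d else arcIn D d)"

lemma arc_outs: "d \<in> ports D \<Longrightarrow> arc d \<in> outs D"
  by (auto simp: arc_def ports_eq arcIn_outs)

lemma ports_cases:
  assumes "d \<in> ports D"
  obtains (out) "d \<in> outs D" | (inc) "d \<in> ins D" "d \<notin> outs D"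
  using assms outs_ins_disjoint by (auto simp: ports_eq)

lemma arc_out: "p \<in> outs D \<Longrightarrow> arc p = p"
  by (simp add: arc_def)

lemma arc_in: "q \<in> ins D \<Longrightarrow> arc q = arcIn D q"
  using outs_ins_disjoint[of q] by (auto simp: arc_def)

lemma arc_nxt: "p \<in> outs D \<Longrightarrow> arc (nxt D p) = p"
  by (simp add: arc_in nxt_ins arcIn_nxt)

lemma alpha_out: "p \<in> outs D \<Longrightarrow> alpha D p = nxt D p"
  by (simp add: alpha_def)

lemma alpha_in: "q \<in> ins D \<Longrightarrow> alpha D q = arcIn D q"
  using outs_ins_disjoint[of q] by (auto simp: alpha_def)

lemma alpha_props:
  assumes "d \<in> ports D"
  shows "alpha D d \<in> ports D" "alpha D d \<noteq> d" "alpha D (alpha D d) = d" "arc (alpha D d) = arc d"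
proof -
  have "alpha D d \<in> ports D \<and> alpha D d \<noteq> d \<and> alpha D (alpha D d) = d \<and> arc (alpha D d) = arc d"
    using assms
  proof (cases rule: ports_cases)
    case out
    then have "nxt D d \<in> ins D" "nxt D d \<noteq> d" using nxt_ins[of d] outs_ins_disjoint[of d] by auto
    with out show "alpha D d \<in> ports D \<and> alpha D d \<noteq> d \<and> alpha D (alpha D d) = d \<and> arc (alpha D d) = arc d"
      by (simp add: ports_eq alpha_out alpha_in arcIn_nxt arc_out arc_nxt)
  next
    case inc
    then have "arcIn D d \<in> outs D" "arcIn D d \<noteq> d" using arcIn_outs[of d] by auto
    with inc show "alpha D d \<in> ports D \<and> alpha D d \<noteq> d \<and> alpha D (alpha D d) = d \<and> arc (alpha D d) = arc d"
      by (simp add: ports_eq alpha_out alpha_in nxt_arcIn arc_out arc_in)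
  qed
  then show "alpha D d \<in> ports D" "alpha D d \<noteq> d" "alpha D (alpha D d) = d" "arc (alpha D d) = arc d"
    by blast+
qed

lemma arc_eqD:
  assumes "d \<in> ports D" "e \<in> ports D" "arc d = arc e"
  shows "e = d \<or> e = alpha D d"
proof -
  have end_arc: "x = arc x \<or> x = nxt D (arc x)" if "x \<in> ports D" for x
    using that by (cases rule: ports_cases) (simp_all add: arc_out arc_in nxt_arcIn)
  have "alpha D (arc d) = nxt D (arc d)" using assms(1) arc_outs alpha_out by simp
  then show ?thesis
    using end_arc[OF assms(1)] end_arc[OF assms(2)] assms(3) alpha_props(3)[of "arc d"] assms(1)
      arc_outs[OF assms(1)] by (metis UnI1 ports_eq)
qed

text \<open>A resolution \<open>m\<close> joins port \<open>j\<close> of crossing \<open>c\<close> to port \<open>xor j (m c)\<close>: the value 1 is the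
disoriented, 2 the straight (virtual) and 3 the oriented resolution.\<close>

definition res :: "(nat \<Rightarrow> nat) \<Rightarrow> nat \<times> nat \<Rightarrow> nat \<times> nat" where
  "res m d = (fst d, xor (snd d) (m (fst d)))"

definition resolution :: "(nat \<Rightarrow> nat) \<Rightarrow> bool" where
  "resolution m \<longleftrightarrow> (\<forall>c. m c \<in> {1, 2, 3})"

text \<open>A loop is a class of arcs joined at crossings; the \<open>ncirc\<close> circles without
  crossings are not included.\<close>

definition loops :: "(nat \<Rightarrow> nat) \<Rightarrow> nat" where
  "loops m = ncomp (outs D) {(arc d, arc (res m d)) | d. d \<in> ports D}"

text \<open>A traversal of the arcs: \<open>u d\<close> says that the arc at the port \<open>d\<close> is left through \<open>d\<close>.\<close>

definition oriented :: "(nat \<times> nat \<Rightarrow> bool) \<Rightarrow> bool" where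
  "oriented u \<longleftrightarrow> (\<forall>d\<in>ports D. u (alpha D d) = (\<not> u d))"

text \<open>Of two joined ports one is used for arriving and the other for departing, so the
  traversal runs consistently along every loop.\<close>

definition compat :: "(nat \<times> nat \<Rightarrow> bool) \<Rightarrow> (nat \<Rightarrow> nat) \<Rightarrow> bool" where
  "compat u m \<longleftrightarrow> (\<forall>d\<in>ports D. u (res m d) = (\<not> u d))"

text \<open>The traversal of an arc starts at the end where \<open>u\<close> holds and arrives at
  the end where \<open>u\<close> fails; the latter is the head.\<close>

definition head :: "(nat \<times> nat \<Rightarrow> bool) \<Rightarrow> nat \<times> nat \<Rightarrow> nat \<times> nat" where
  "head u p = (if u p then nxt D p else p)"

text \<open>The successor of an arc in the traversal, extended by the identity so that it fits the
  library notion \<open>permutes\<close>.\<close>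

definition step :: "(nat \<times> nat \<Rightarrow> bool) \<Rightarrow> (nat \<Rightarrow> nat) \<Rightarrow> nat \<times> nat \<Rightarrow> nat \<times> nat" where
  "step u m p = (if p \<in> outs D then arc (res m (head u p)) else p)"

lemma res_ports:
  assumes "resolution m" "d \<in> ports D"
  shows "res m d \<in> ports D" "res m d \<noteq> d" "res m (res m d) = d"
proof -
  obtain c j where d: "d = (c, j)" "c < ncr D" "j < 4" using assms(2) by (auto simp: ports_def)
  moreover have "m c \<in> {1, 2, 3}" using assms(1) by (auto simp: resolution_def)
  ultimately show "res m d \<in> ports D" "res m d \<noteq> d" "res m (res m d) = d"
    using xor_partner[of j "m c"] by (auto simp: res_def ports_def)
qed

lemma head_props:
  assumes "oriented u" "p \<in> outs D"
  shows "head u p \<in> ports D" "\<not> u (head u p)" "arc (head u p) = p"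
proof -
  have "p \<in> ports D" "nxt D p \<in> ports D" using assms(2) nxt_ins by (simp_all add: ports_eq)
  moreover from this have "u (nxt D p) = (\<not> u p)"
    using assms alpha_out[of p] unfolding oriented_def by metis
  ultimately show "head u p \<in> ports D" "\<not> u (head u p)" "arc (head u p) = p"
    using assms(2) by (simp_all add: head_def arc_out arc_nxt)
qed

lemma head_arc:
  assumes "oriented u" "d \<in> ports D" "\<not> u d"
  shows "head u (arc d) = d"
  using assms(2)
proof (cases rule: ports_cases)
  case out
  then show ?thesis using assms(3) by (simp add: head_def arc_out)
next
  case inc
  then have "u (arcIn D d)"
    using assms alpha_in[of d] unfolding oriented_def by metis
  with inc show ?thesis by (simp add: head_def arc_in nxt_arcIn)
qed

lemma arc_inj_oriented:
  assumes "oriented u" "d \<in> ports D" "e \<in> ports D" "arc d = arc e" "u d = u e"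
  shows "d = e"
  using arc_eqD[OF assms(2-4)] assms by (auto simp: oriented_def)

text \<open>Every stage can be undone: a head determines its arc, \<open>res m\<close> is an
  involution taking ports with \<open>u\<close> false to ports with \<open>u\<close> true, and
  \<open>arc\<close> is injective on ports with equal \<open>u\<close>. Surjectivity follows by
  finiteness.\<close>

lemma step_permutes:
  assumes m: "resolution m" and u: "oriented u" and um: "compat u m"
  shows "step u m permutes outs D"
proof (rule bij_imp_permutes)
  have "step u m p \<in> outs D" if "p \<in> outs D" for p
    using that head_props[OF u that] res_ports[OF m] by (simp add: step_def arc_outs)
  moreover have "inj_on (step u m) (outs D)"
  proof (rule inj_onI)
    fix p q assume p: "p \<in> outs D" and q: "q \<in> outs D" and "step u m p = step u m q"
    then have *: "arc (res m (head u p)) = arc (res m (head u q))" by (simp add: step_def)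
    note hp = head_props[OF u p] and hq = head_props[OF u q]
    have "u (res m (head u p))" "u (res m (head u q))"
      using um hp(1,2) hq(1,2) unfolding compat_def by metis+
    then have "res m (head u p) = res m (head u q)"
      using arc_inj_oriented[OF u res_ports(1)[OF m hp(1)] res_ports(1)[OF m hq(1)] *] by simp
    then have "head u p = head u q"
      using res_ports(3)[OF m hp(1)] res_ports(3)[OF m hq(1)] by metis
    then show "p = q" using hp(3) hq(3) by metis
  qed
  ultimately show "bij_betw (step u m) (outs D) (outs D)"
    using finite_outs by (simp add: bij_betw_def endo_inj_surj image_subsetI)
qed (simp add: step_def)

text \<open>Of two joined ports exactly one is the head of its arc. Hence \<open>step\<close> lists
  every junction once, in the direction of the traversal, and both relations have the same symmetric
  closure.\<close>

lemma loops_eq_cycles: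
  assumes m: "resolution m" and u: "oriented u" and um: "compat u m"
  shows "loops m = ncomp (outs D) {(p, step u m p) | p. p \<in> outs D}"
proof -
  let ?A = "{(arc d, arc (res m d)) | d. d \<in> ports D}"
  let ?S = "{(p, step u m p) | p. p \<in> outs D}"
  have conv: "?A\<inverse> = ?A"
  proof -
    have "(arc (res m d), arc d) \<in> ?A" if "d \<in> ports D" for d
      using res_ports(1,3)[OF m that] by (intro CollectI exI[of _ "res m d"]) simp
    then have "?A\<inverse> \<subseteq> ?A" by blast
    then show ?thesis by blast
  qed
  have "(p, step u m p) \<in> ?A" if "p \<in> outs D" for p
    using head_props(1,3)[OF u that] that by (intro CollectI exI[of _ "head u p"]) (simp add: step_def)
  then have "?S \<subseteq> ?A" by blast
  moreover have "(arc d, arc (res m d)) \<in> ?S \<union> ?S\<inverse>" if d: "d \<in> ports D" for d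
  proof (cases "u d")
    case True
    then have r: "\<not> u (res m d)" using um d by (auto simp: compat_def)
    have "step u m (arc (res m d)) = arc d"
      using head_arc[OF u _ r] res_ports[OF m d] arc_outs[of "res m d"] by (simp add: step_def)
    moreover have "arc (res m d) \<in> outs D" using arc_outs res_ports[OF m d] by simp
    ultimately have "(arc (res m d), arc d) \<in> ?S"
      by (intro CollectI exI[of _ "arc (res m d)"]) simp
    then show ?thesis by blast
  next
    case False
    then have "step u m (arc d) = arc (res m d)"
      using head_arc[OF u d] arc_outs[OF d] by (simp add: step_def)
    then have "(arc d, arc (res m d)) \<in> ?S"
      using arc_outs[OF d] by (intro CollectI exI[of _ "arc d"]) simp
    then show ?thesis by blast
  qed
  then have "?A \<subseteq> ?S \<union> ?S\<inverse>" by blast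
  ultimately have "?A \<union> ?A\<inverse> = ?S \<union> ?S\<inverse>" using conv by blast
  then show ?thesis by (simp add: loops_def ncomp_def)
qed

text \<open>The traversal arrives at \<open>c\<close> through two ports and departs through the
  other two. The two compatible resolutions match these in the two possible ways, so switching
  precomposes \<open>step\<close> with the transposition of the two arriving arcs.\<close>

lemma loops_switch:
  assumes u: "oriented u" and m: "resolution m" "compat u m"
    and m': "resolution (m(c := v))" "compat u (m(c := v))"
    and c: "c < ncr D" and v: "v \<noteq> m c"
  shows "even (loops (m(c := v))) \<longleftrightarrow> odd (loops m)"
proof -
  let ?m = "m(c := v)"
  have vals: "m c \<in> {1, 2, 3}" "v \<in> {1, 2, 3}"
    using m(1) m'(1) by (auto simp: resolution_def dest: spec[of _ c])
  have um: "u (c, xor j (m c)) = (\<not> u (c, j))" and uv: "u (c, xor j v) = (\<not> u (c, j))" if "j < 4" for j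
    using that bspec[OF m(2)[unfolded compat_def], of "(c, j)"]
      bspec[OF m'(2)[unfolded compat_def], of "(c, j)"] c
    by (simp_all add: ports_def res_def)
  obtain j where j: "j < 4" "\<not> u (c, j)"
    using um[of 0] xor_partner[of 0, OF _ vals(1)] by (metis zero_less_numeral)
  \<comment> \<open>Following one pairing and then the other leads from an arriving port to a
    departing one and on to the second arriving port.\<close>
  let ?k = "xor (xor j (m c)) v"
  note K = xor_klein[OF j(1) vals v[symmetric]]
  have k: "?k < 4" "?k \<noteq> j" "\<not> u (c, ?k)"
    using K um[OF j(1)] uv[of "xor j (m c)"] xor_partner[OF j(1) vals(1)] j(2) by auto
  let ?d = "(c, j)" and ?e = "(c, ?k)"
  have de: "?d \<in> ports D" "?e \<in> ports D" using j k c by (auto simp: ports_def)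
  have h: "head u (arc ?d) = ?d" "head u (arc ?e) = ?e"
    using head_arc[OF u] de j k by auto
  have ne: "arc ?d \<noteq> arc ?e" using h k(2) by auto
  have "step u ?m p = (step u m \<circ> transpose (arc ?d) (arc ?e)) p" for p
  proof (cases "p \<in> outs D")
    case False
    then show ?thesis using arc_outs de by (auto simp: step_def transpose_def)
  next
    case p: True
    consider "p = arc ?d" | "p = arc ?e" | "p \<noteq> arc ?d" "p \<noteq> arc ?e" by blast
    then show ?thesis
    proof cases
      case 3
      note hp = head_props[OF u p]
      obtain c' i where ci: "head u p = (c', i)" by fastforce
      have "c' \<noteq> c"
      proof
        assume [simp]: "c' = c"
        have "i < 4" using hp(1) ci by (auto simp: ports_def)
        from K(5)[OF this] show False
          using 3 hp ci um[OF j(1)] uv[OF j(1)] j(2) by auto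
      qed
      then show ?thesis using 3 p ci by (simp add: step_def res_def)
    next
      case 1
      have "step u ?m p = arc (c, xor j v)"
        unfolding step_def 1 h if_P[OF arc_outs[OF de(1)]] by (simp add: res_def)
      moreover have "step u m (arc ?e) = arc (c, xor j v)"
        unfolding step_def h if_P[OF arc_outs[OF de(2)]] by (simp add: res_def K(3))
      ultimately show ?thesis by (simp add: 1 transpose_def)
    next
      case 2
      have "step u ?m p = arc (c, xor j (m c))"
        unfolding step_def 2 h if_P[OF arc_outs[OF de(2)]] by (simp add: res_def K(4))
      moreover have "step u m (arc ?d) = arc (c, xor j (m c))"
        unfolding step_def h if_P[OF arc_outs[OF de(1)]] by (simp add: res_def)
      ultimately show ?thesis by (simp add: 2 transpose_def)
    qed
  qed
  then have "step u ?m = step u m \<circ> transpose (arc ?d) (arc ?e)" by (rule ext)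
  then show ?thesis
    unfolding loops_eq_cycles[OF m(1) u m(2)] loops_eq_cycles[OF m'(1) u m'(2)]
    using ncomp_transpose[OF finite_outs step_permutes[OF m(1) u m(2)]
        arc_outs[OF de(1)] arc_outs[OF de(2)] ne] by simp
qed

text \<open>The crossings of \<open>C\<close> are switched one at a time. Compatibility is a
  condition at each crossing separately, so every mixture of \<open>m\<close> and \<open>m'\<close>
  is compatible as well.\<close>

lemma loops_change:
  assumes u: "oriented u" and m: "resolution m" "compat u m"
    and C: "finite C" "C \<subseteq> {..<ncr D}"
    and m': "resolution m'" "compat u m'"
    and diff: "\<And>c. c \<in> C \<Longrightarrow> m' c \<noteq> m c" "\<And>c. c \<notin> C \<Longrightarrow> m' c = m c"
  shows "even (loops m') \<longleftrightarrow> even (loops m + card C)"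
  using C m' diff
proof (induction C arbitrary: m' rule: finite_induct)
  case empty
  then have "m' = m" by auto
  then show ?case by simp
next
  case (insert c C)
  let ?n = "m'(c := m c)"
  have n: "resolution ?n" using insert.prems m by (simp add: resolution_def)
  have un: "compat u ?n" unfolding compat_def
  proof
    fix d assume "d \<in> ports D"
    moreover have "res ?n d = res m d \<or> res ?n d = res m' d" by (simp add: res_def)
    ultimately show "u (res ?n d) = (\<not> u d)"
      using insert.prems(3) m(2) unfolding compat_def by metis
  qed
  have "even (loops ?n) \<longleftrightarrow> even (loops m + card C)"
  proof (rule insert.IH[OF _ n un])
    show "?n e \<noteq> m e" if "e \<in> C" for e
      using that insert.hyps(2) insert.prems(4)[of e] by auto
    show "?n e = m e" if "e \<notin> C" for e
      using that insert.prems(5)[of e] by auto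
  qed (use insert.prems(1) in simp)
  moreover have "even (loops (?n(c := m' c))) \<longleftrightarrow> odd (loops ?n)"
    using n un insert.prems by (intro loops_switch[OF u]) simp_all
  ultimately have "even (loops m') \<longleftrightarrow> odd (loops m + card C)" by simp
  then show ?case using insert.hyps by simp
qed

end

section \<open>Cycles of a planar diagram bound faces\<close>

text \<open>Rank-nullity over the field with two elements in counting form: subsets under symmetric
  difference are vectors, and every nonempty fibre of \<phi> is a translate of the kernel.\<close>

lemma card_ker_im_Pow:
  assumes A: "finite A"
    and add: "\<And>S T. S \<subseteq> A \<Longrightarrow> T \<subseteq> A \<Longrightarrow> \<phi> (sym_diff S T) = sym_diff (\<phi> S) (\<phi> T)"
  shows "card {S. S \<subseteq> A \<and> \<phi> S = {}} * card (\<phi> ` Pow A) = 2 ^ card A"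
proof -
  have fib: "card {S \<in> Pow A. \<phi> S = b} = card {S. S \<subseteq> A \<and> \<phi> S = {}}" if b: "b \<in> \<phi> ` Pow A" for b
  proof -
    obtain T where T: "T \<subseteq> A" "b = \<phi> T" using b by blast
    have "bij_betw (\<lambda>S. sym_diff S T) {S \<in> Pow A. \<phi> S = b} {S. S \<subseteq> A \<and> \<phi> S = {}}"
    proof (rule bij_betw_byWitness[where f' = "\<lambda>S. sym_diff S T"])
      show "(\<lambda>S. sym_diff S T) ` {S \<in> Pow A. \<phi> S = b} \<subseteq> {S. S \<subseteq> A \<and> \<phi> S = {}}"
      proof clarify
        fix S assume "S \<subseteq> A" "b = \<phi> S"
        then show "sym_diff S T \<subseteq> A \<and> \<phi> (sym_diff S T) = {}" using T add[of S T] by auto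
      qed
      show "(\<lambda>S. sym_diff S T) ` {S. S \<subseteq> A \<and> \<phi> S = {}} \<subseteq> {S \<in> Pow A. \<phi> S = b}"
      proof clarify
        fix S assume "S \<subseteq> A" "\<phi> S = {}"
        then show "sym_diff S T \<in> Pow A \<and> \<phi> (sym_diff S T) = b" using T add[of S T] by auto
      qed
    qed auto
    then show ?thesis by (rule bij_betw_same_card)
  qed
  have "2 ^ card A = card (Pow A)" using A by (simp add: card_Pow)
  also have "\<dots> = (\<Sum>b\<in>\<phi> ` Pow A. card {S \<in> Pow A. \<phi> S = b})"
    using sum.image_gen[of "Pow A" "\<lambda>_. 1::nat" \<phi>] A by simp
  also have "\<dots> = (\<Sum>b\<in>\<phi> ` Pow A. card {S. S \<subseteq> A \<and> \<phi> S = {}})"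
    by (rule sum.cong[OF refl fib])
  also have "\<dots> = card {S. S \<subseteq> A \<and> \<phi> S = {}} * card (\<phi> ` Pow A)" by simp
  finally show ?thesis ..
qed

text \<open>Modulo the subspace \<open>I\<close> each vertex equals the representative of its
  component. So every set of vertices is an element of \<open>I\<close> plus a set of
  representatives.\<close>

lemma card_boundaries:
  assumes "finite V"
    and I0: "{} \<in> I" and fI: "finite I"
    and Iadd: "\<And>S T. S \<in> I \<Longrightarrow> T \<in> I \<Longrightarrow> sym_diff S T \<in> I"
    and edge: "\<And>x y. (x, y) \<in> R \<Longrightarrow> x \<in> V \<Longrightarrow> y \<in> V \<Longrightarrow> sym_diff {x} {y} \<in> I"
  shows "2 ^ card V \<le> card I * 2 ^ ncomp V R"
proof -
  let ?rep = "\<lambda>v. SOME w. w \<in> conn V R `` {v}"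
  let ?W = "(\<lambda>C. SOME w. w \<in> C) ` (V // conn V R)"
  let ?G = "(\<lambda>(B, U). sym_diff B U) ` (I \<times> Pow ?W)"
  have fQ: "finite (V // conn V R)" using assms(1) by (simp add: quotient_def)
  have conn_I: "sym_diff {x} {y} \<in> I" if "(x, y) \<in> conn V R" for x y
    using that
  proof (induction rule: rtrancl_induct)
    case base
    then show ?case using I0 by simp
  next
    case (step y z)
    then have "sym_diff {y} {z} \<in> I" using edge[of y z] edge[of z y] by (auto simp: Un_commute)
    from Iadd[OF step.IH this] show ?case
      by (rule back_subst[of "\<lambda>S. S \<in> I"]) auto
  qed
  have GI: "sym_diff B U \<in> ?G" if "B \<in> I" "U \<subseteq> ?W" for B U
    using that by (intro image_eqI[of _ _ "(B, U)"]) simp_all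
  have Gadd: "sym_diff S T \<in> ?G" if S: "S \<in> ?G" and T: "T \<in> ?G" for S T
  proof -
    obtain B U where 1: "S = sym_diff B U" "B \<in> I" "U \<subseteq> ?W"
      using S by (elim imageE) auto
    obtain B' U' where 2: "T = sym_diff B' U'" "B' \<in> I" "U' \<subseteq> ?W"
      using T by (elim imageE) auto
    have "sym_diff (sym_diff B U) (sym_diff B' U') = sym_diff (sym_diff B B') (sym_diff U U')"
      by blast
    moreover have "sym_diff (sym_diff B B') (sym_diff U U') \<in> ?G"
      using 1(3) 2(3) by (intro GI Iadd[OF 1(2) 2(2)]) blast
    ultimately show ?thesis unfolding 1(1) 2(1) by simp
  qed
  have single: "{v} \<in> ?G" if v: "v \<in> V" for v
  proof -
    have "?rep v \<in> conn V R `` {v}" by (rule someI[of _ v]) simp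
    then have "sym_diff {v} {?rep v} \<in> I" by (intro conn_I) simp
    moreover have "?rep v \<in> ?W"
      using imageI[OF quotientI[OF v, of "conn V R"], of "\<lambda>C. SOME w. w \<in> C"] by simp
    ultimately have "sym_diff (sym_diff {v} {?rep v}) {?rep v} \<in> ?G" by (intro GI) blast+
    moreover have "sym_diff (sym_diff {v} {?rep v}) {?rep v} = {v}" by blast
    ultimately show ?thesis by simp
  qed
  have "S \<in> ?G" if "finite S" "S \<subseteq> V" for S
    using that
  proof (induction rule: finite_induct)
    case empty
    show ?case using GI[OF I0, of "{}"] by simp
  next
    case (insert v S)
    then have "sym_diff {v} S \<in> ?G" by (intro Gadd single) auto
    moreover have "sym_diff {v} S = insert v S" using insert.hyps by blast
    ultimately show ?case by simp
  qed
  then have "Pow V \<subseteq> ?G" using assms(1) finite_subset by blast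
  moreover have "finite (I \<times> Pow ?W)" using fI fQ by simp
  ultimately have "card (Pow V) \<le> card (I \<times> Pow ?W)" by (rule surj_card_le[rotated])
  also have "\<dots> = card I * 2 ^ card ?W" using fQ by (simp add: card_cartesian_product card_Pow)
  also have "\<dots> \<le> card I * 2 ^ ncomp V R"
    unfolding ncomp_def using card_image_le[OF fQ] by (intro mult_left_mono power_increasing) auto
  finally show ?thesis using assms(1) by (simp add: card_Pow)
qed

lemma odd_card_less4: "odd (card {j::nat. j < 4 \<and> P j}) \<longleftrightarrow> (P 0 \<noteq> (P 1 \<noteq> (P 2 \<noteq> P 3)))"
proof -
  have "card {j::nat. j < 4 \<and> P j} = (\<Sum>j<4. if P j then 1 else 0)"
    by (subst sum.inter_filter[symmetric]) auto
  also have "\<dots> = of_bool (P 0) + of_bool (P 1) + of_bool (P 2) + of_bool (P 3)"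
    by (simp add: numeral_eq_Suc)
  finally show ?thesis by auto
qed

lemma rot_ports: "d \<in> ports D \<Longrightarrow> rot d \<in> ports D"
  by (auto simp: rot_def ports_def)

lemma rot_simps: "rot (c, 0) = (c, 1)" "rot (c, 1) = (c, 2)" "rot (c, 2) = (c, 3)" "rot (c, 3) = (c, 0)"
  by (simp_all add: rot_def)

section \<open>Chains modulo 2: crossings, arcs and faces\<close>

context diagram
begin

text \<open>The boundary map modulo 2: the crossings met by an odd number of arc ends from
  \<open>E\<close>. The nested inequalities are an exclusive or, in which the two ends of an arc at
  one crossing cancel.\<close>

definition boundary :: "(nat \<times> nat) set \<Rightarrow> nat set" where
  "boundary E = {c. c < ncr D \<and>
     ((arc (c, 0) \<in> E) \<noteq> ((arc (c, 1) \<in> E) \<noteq> ((arc (c, 2) \<in> E) \<noteq> (arc (c, 3) \<in> E))))}"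

definition graphRel :: "(nat \<times> nat) set" where
  "graphRel = {(fst p, fst (nxt D p)) | p. p \<in> outs D}"

text \<open>Going out along a dart and then taking the next dart counterclockwise keeps the same
  region on the right, so \<open>face d\<close> is the face to the right of
  \<open>d\<close>.\<close>

definition face :: "nat \<times> nat \<Rightarrow> (nat \<times> nat) set" where
  "face d = conn (ports D) {(d, rot (alpha D d)) | d. d \<in> ports D} `` {d}"

definition faces :: "(nat \<times> nat) set set" where
  "faces = ports D // conn (ports D) {(d, rot (alpha D d)) | d. d \<in> ports D}"

text \<open>\<open>p\<close> and \<open>nxt D p\<close> are the two opposite darts of one arc, so
  their faces are the two sides of that arc.\<close>

definition coboundary :: "(nat \<times> nat) set set \<Rightarrow> (nat \<times> nat) set" where
  "coboundary W = {p \<in> outs D. (face p \<in> W) \<noteq> (face (nxt D p) \<in> W)}"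

lemma finite_faces: "finite faces"
  and card_faces: "card faces = nfaces D"
  using finite_ports by (simp_all add: faces_def nfaces_def ncomp_def quotient_def)

lemma facesE: "F \<in> faces \<Longrightarrow> (\<And>d. d \<in> ports D \<Longrightarrow> F = face d \<Longrightarrow> thesis) \<Longrightarrow> thesis"
  by (auto simp: face_def faces_def elim: quotientE)

text \<open>Both are the face to the left of \<open>d\<close>.\<close>

lemma face_rot:
  assumes "d \<in> ports D"
  shows "face (rot d) = face (alpha D d)"
proof -
  let ?R = "{(d, rot (alpha D d)) | d. d \<in> ports D}"
  have "(alpha D d, rot (alpha D (alpha D d))) \<in> ?R" using alpha_props(1)[OF assms] by blast
  then have "(alpha D d, rot d) \<in> conn (ports D) ?R"
    using alpha_props[OF assms] rot_ports[OF assms] by (intro conn_edge) simp_all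
  then show ?thesis unfolding face_def conn_class_eq by (rule conn_sym)
qed

lemma arc_coboundary:
  assumes "d \<in> ports D"
  shows "arc d \<in> coboundary W \<longleftrightarrow> (face d \<in> W) \<noteq> (face (rot d) \<in> W)"
  using assms
proof (cases rule: ports_cases)
  case out
  then show ?thesis by (auto simp: coboundary_def arc_out alpha_out face_rot[OF assms])
next
  case inc
  then show ?thesis using arcIn_outs[of d]
    by (auto simp: coboundary_def arc_in alpha_in nxt_arcIn face_rot[OF assms])
qed

text \<open>On a full turn around a crossing, membership of the faces in \<open>W\<close> changes an
  even number of times.\<close>

lemma boundary_coboundary: "boundary (coboundary W) = {}"
  by (auto simp: boundary_def arc_coboundary ports_def rot_simps[unfolded One_nat_def])

lemma boundary_add: "boundary (sym_diff S T) = sym_diff (boundary S) (boundary T)"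
  by (auto simp: boundary_def)

lemma coboundary_add: "coboundary (sym_diff S T) = sym_diff (coboundary S) (coboundary T)"
  by (auto simp: coboundary_def)

lemma boundary_single:
  assumes "p \<in> outs D"
  shows "boundary {p} = sym_diff {fst p} {fst (nxt D p)}"
proof -
  have n: "nxt D p \<in> ins D" using assms by (rule nxt_ins)
  have a: "arc (c, j) = p \<longleftrightarrow> (c, j) = p" if "c < ncr D" "j = 2 \<or> j = 3" for c j
    using that by (simp add: arc_out outs_def)
  have b: "arc (c, j) = p \<longleftrightarrow> (c, j) = nxt D p" if "c < ncr D" "j = 0 \<or> j = 1" for c j
  proof -
    have "(c, j) \<in> ins D" using that by (simp add: ins_def)
    then show ?thesis using nxt_arcIn arc_in arcIn_nxt[OF assms] by metis
  qed
  have o: "\<exists>c j. p = (c, j) \<and> c < ncr D \<and> (j = 2 \<or> j = 3)" using assms by (auto simp: outs_def)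
  have i: "\<exists>c j. nxt D p = (c, j) \<and> c < ncr D \<and> (j = 0 \<or> j = 1)" using n by (auto simp: ins_def)
  have "c \<in> boundary {p} \<longleftrightarrow> c \<in> sym_diff {fst p} {fst (nxt D p)}" for c
    using a[of c 2] a[of c 3] b[of c 0] b[of c 1] o i by (auto simp: boundary_def)
  then show ?thesis by blast
qed

text \<open>The boundary of a single arc is the sum of its end crossings, so the image has
  codimension at most the number of graph components.\<close>

lemma card_boundary_image: "2 ^ ncr D \<le> card (boundary ` Pow (outs D)) * 2 ^ ngraphcomp D"
proof -
  have "2 ^ card {..<ncr D} \<le> card (boundary ` Pow (outs D)) * 2 ^ ncomp {..<ncr D} graphRel"
  proof (rule card_boundaries)
    show "{} \<in> boundary ` Pow (outs D)"
      by (rule image_eqI[of _ _ "{}"]) (simp_all add: boundary_def)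
    show "sym_diff S T \<in> boundary ` Pow (outs D)"
      if S: "S \<in> boundary ` Pow (outs D)" and T: "T \<in> boundary ` Pow (outs D)" for S T
    proof -
      obtain A B where "S = boundary A" "T = boundary B" "A \<subseteq> outs D" "B \<subseteq> outs D"
        using S T by auto
      then show ?thesis
        by (intro image_eqI[of _ _ "sym_diff A B"]) (auto simp only: boundary_add)
    qed
    show "sym_diff {x} {y} \<in> boundary ` Pow (outs D)" if "(x, y) \<in> graphRel" for x y
    proof -
      obtain p where "p \<in> outs D" "x = fst p" "y = fst (nxt D p)"
        using \<open>(x, y) \<in> graphRel\<close> unfolding graphRel_def by blast
      then show ?thesis using boundary_single[of p] by (intro image_eqI[of _ _ "{p}"]) simp_all
    qed
  qed (simp_all add: finite_outs)
  then show ?thesis by (simp add: ngraphcomp_def graphRel_def)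
qed

text \<open>There are 2n arcs for n crossings, and with g graph components the boundary map has rank
  at least n - g; its kernel therefore has dimension at most n + g.\<close>

lemma card_cycles: "card {E. E \<subseteq> outs D \<and> boundary E = {}} \<le> 2 ^ (ncr D + ngraphcomp D)"
proof -
  let ?K = "{E. E \<subseteq> outs D \<and> boundary E = {}}"
  have "card ?K * 2 ^ ncr D \<le> card ?K * (card (boundary ` Pow (outs D)) * 2 ^ ngraphcomp D)"
    using card_boundary_image by (rule mult_le_mono2)
  also have "\<dots> = 2 ^ (2 * ncr D) * 2 ^ ngraphcomp D"
    using card_ker_im_Pow[of "outs D" boundary, OF finite_outs boundary_add]
    by (simp add: card_outs mult.assoc[symmetric])
  also have "\<dots> = 2 ^ (ncr D + ngraphcomp D) * 2 ^ ncr D" by (simp add: power_add mult_2)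
  finally show ?thesis by simp
qed

text \<open>If no arc separates \<open>W\<close> from its complement, membership in \<open>W\<close>
  is constant around each crossing and along each arc. So \<open>W\<close> is determined by the
  graph components it touches, which \<open>?h\<close> collects.\<close>

lemma card_coboundary_kernel: "card {W. W \<subseteq> faces \<and> coboundary W = {}} \<le> 2 ^ ngraphcomp D"
proof -
  let ?K = "{W. W \<subseteq> faces \<and> coboundary W = {}}"
  let ?V = "{..<ncr D}"
  let ?h = "\<lambda>W. {conn ?V graphRel `` {c} | c. c < ncr D \<and> face (c, 0) \<in> W}"
  have key: "face d \<in> W \<longleftrightarrow> face e \<in> W"
    if W: "coboundary W = {}" and d: "d \<in> ports D" and e: "e \<in> ports D"
      and c: "(fst d, fst e) \<in> conn ?V graphRel" for W d e
  proof -
    have r: "face (rot d) \<in> W \<longleftrightarrow> face d \<in> W" if "d \<in> ports D" for d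
      using arc_coboundary[OF that, of W] W by auto
    have f: "face d \<in> W \<longleftrightarrow> face (fst d, 0) \<in> W" if d: "d \<in> ports D" for d
    proof -
      obtain c j where cj: "d = (c, j)" "c < ncr D" "j < 4" using d by (auto simp: ports_def)
      then show ?thesis
        using r[of "(c, 0)"] r[of "(c, 1)"] r[of "(c, 2)"] unfolding less4 rot_simps
        by (auto simp: ports_def)
    qed
    have g: "face (x, 0) \<in> W \<longleftrightarrow> face (y, 0) \<in> W" if "(x, y) \<in> graphRel" for x y
    proof -
      obtain p where p: "p \<in> outs D" "x = fst p" "y = fst (nxt D p)"
        using \<open>(x, y) \<in> graphRel\<close> unfolding graphRel_def by blast
      then have "p \<in> ports D" "nxt D p \<in> ports D" using nxt_ins[of p] by (simp_all add: ports_eq)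
      moreover have "p \<notin> coboundary W" using W by simp
      then have "face p \<in> W \<longleftrightarrow> face (nxt D p) \<in> W" using p(1) by (simp add: coboundary_def)
      ultimately show ?thesis using f p by simp
    qed
    from c have "face (fst d, 0) \<in> W \<longleftrightarrow> face (fst e, 0) \<in> W"
      by (induction rule: rtrancl_induct) (use g in auto)
    then show ?thesis using f d e by simp
  qed
  have "inj_on ?h ?K"
  proof (rule inj_onI)
    have sub: "W \<subseteq> W'" if W: "W \<in> ?K" and W': "W' \<in> ?K" and eq: "?h W = ?h W'" for W W'
    proof
      fix F assume F: "F \<in> W"
      obtain d where d: "d \<in> ports D" "F = face d" using facesE[of F] F W by auto
      have cd: "(fst d, 0) \<in> ports D" "fst d < ncr D" using d by (auto simp: ports_def)
      then have "face (fst d, 0) \<in> W" using key[of W d "(fst d, 0)"] W d F by simp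
      then have "conn ?V graphRel `` {fst d} \<in> ?h W" using cd by auto
      then have "conn ?V graphRel `` {fst d} \<in> ?h W'" using eq by simp
      then obtain c where c: "c < ncr D" "face (c, 0) \<in> W'"
          "conn ?V graphRel `` {fst d} = conn ?V graphRel `` {c}" by blast
      then show "F \<in> W'"
        using key[of W' d "(c, 0)"] W' d unfolding conn_class_eq by (simp add: ports_def)
    qed
    show "W = W'" if "W \<in> ?K" "W' \<in> ?K" "?h W = ?h W'" for W W'
      using sub[OF that] sub[OF that(2,1) that(3)[symmetric]] by blast
  qed
  moreover have "?h ` ?K \<subseteq> Pow (?V // conn ?V graphRel)" by (auto intro: quotientI)
  moreover have "finite (?V // conn ?V graphRel)" by (simp add: quotient_def)
  ultimately have "card ?K \<le> card (Pow (?V // conn ?V graphRel))" by (intro card_inj_on_le) auto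
  also have "\<dots> = 2 ^ ngraphcomp D"
    using \<open>finite (?V // conn ?V graphRel)\<close>
    unfolding ngraphcomp_def ncomp_def graphRel_def by (simp add: card_Pow)
  finally show ?thesis .
qed

end

section \<open>Consequences of Euler's formula\<close>

locale planar_diagram = diagram +
  assumes euler: "nfaces D = ncr D + 2 * ngraphcomp D"
begin

text \<open>With n + 2g faces and a kernel of dimension at most g, the coboundaries have dimension
  at least n + g. They are cycles, and cycles have dimension at most n + g, so the two spaces
  coincide.\<close>

lemma cycle_is_coboundary:
  assumes "E \<subseteq> outs D" "boundary E = {}"
  shows "\<exists>W. E = coboundary W"
proof -
  let ?K = "{E. E \<subseteq> outs D \<and> boundary E = {}}"
  have "coboundary W \<in> ?K" for W by (simp add: boundary_coboundary) (auto simp: coboundary_def)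
  then have "coboundary ` Pow faces \<subseteq> ?K" by blast
  moreover have "card ?K \<le> card (coboundary ` Pow faces)"
  proof -
    have "2 ^ (ncr D + ngraphcomp D) * 2 ^ ngraphcomp D
        = card {W. W \<subseteq> faces \<and> coboundary W = {}} * card (coboundary ` Pow faces)"
      unfolding card_ker_im_Pow[of faces coboundary, OF finite_faces coboundary_add] card_faces euler
      by (simp add: power_add mult_2)
    also have "\<dots> \<le> 2 ^ ngraphcomp D * card (coboundary ` Pow faces)"
      using card_coboundary_kernel by (rule mult_le_mono1)
    finally have "2 ^ (ncr D + ngraphcomp D) \<le> card (coboundary ` Pow faces)"
      by (simp add: mult.commute)
    with card_cycles show ?thesis by simp
  qed
  moreover have "finite ?K" by (rule finite_subset[of _ "Pow (outs D)"]) (use finite_outs in auto)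
  ultimately have "coboundary ` Pow faces = ?K" by (rule card_seteq[rotated])
  then have "E \<in> coboundary ` Pow faces" using assms by simp
  then show ?thesis by (rule imageE) (rule exI)
qed

text \<open>Both straight strands are traversed consistently, one along and the other against the
  orientation of the diagram.\<close>

definition transverse :: "(nat \<times> nat \<Rightarrow> bool) \<Rightarrow> nat set" where
  "transverse u = {c. c < ncr D \<and> u (c, 2) = (\<not> u (c, 0)) \<and> u (c, 3) = (\<not> u (c, 1)) \<and> u (c, 0) \<noteq> u (c, 1)}"

text \<open>The arcs traversed backwards form a mod 2 cycle, hence bound a set of faces. Following the
arcs traversed forwards, the colour of the face on the side changes exactly at the transverse crossings.\<close>
lemma even_transverse:
  assumes u: "oriented u" and m: "resolution m" "compat u m"
  shows "even (card (transverse u))"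
proof -
  define E where "E = {p \<in> outs D. \<not> u p}"
  have y: "arc d \<in> E \<longleftrightarrow> (if d \<in> outs D then \<not> u d else u d)" if "d \<in> ports D" for d
    using that
  proof (cases rule: ports_cases)
    case out
    then show ?thesis by (simp add: arc_out E_def)
  next
    case inc
    moreover have "u (arcIn D d) = (\<not> u d)"
      using u that alpha_in[of d] inc unfolding oriented_def by metis
    ultimately show ?thesis using arcIn_outs[of d] by (simp add: arc_in E_def)
  qed
  have arcs: "arc (c, 0) \<in> E \<longleftrightarrow> u (c, 0)" "arc (c, 1) \<in> E \<longleftrightarrow> u (c, 1)"
      "arc (c, 2) \<in> E \<longleftrightarrow> \<not> u (c, 2)" "arc (c, 3) \<in> E \<longleftrightarrow> \<not> u (c, 3)" if "c < ncr D" for c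
    using that y[of "(c, 0)"] y[of "(c, 1)"] y[of "(c, 2)"] y[of "(c, 3)"]
    by (simp_all add: ports_def outs_def)
  \<comment> \<open>Together the two facts say that \<open>u\<close> holds at exactly two of the
    four ports.\<close>
  have balanced: "u (c, 0) = (u (c, 1) = (u (c, 2) = u (c, 3)))"
     "\<not> (u (c, 0) = u (c, 1) \<and> u (c, 1) = u (c, 2))" if c: "c < ncr D" for c
  proof -
    have "m c = 1 \<or> m c = 2 \<or> m c = 3" using m(1) unfolding resolution_def by blast
    moreover have x: "u (c, xor j (m c)) = (\<not> u (c, j))" if "j < 4" for j
      using bspec[OF m(2)[unfolded compat_def], of "(c, j)"] that c by (simp add: ports_def res_def)
    ultimately have "u (c, 1) = (\<not> u (c, 0)) \<and> u (c, 3) = (\<not> u (c, 2))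
        \<or> u (c, 2) = (\<not> u (c, 0)) \<and> u (c, 3) = (\<not> u (c, 1))
        \<or> u (c, 3) = (\<not> u (c, 0)) \<and> u (c, 2) = (\<not> u (c, 1))"
    proof (elim disjE)
      assume "m c = 1"
      then show ?thesis using x[of 0] x[of 2] by simp
    next
      assume "m c = 2"
      then show ?thesis using x[of 0] x[of 1] by simp
    next
      assume "m c = 3"
      then show ?thesis using x[of 0] x[of 1] by simp
    qed
    then show "u (c, 0) = (u (c, 1) = (u (c, 2) = u (c, 3)))"
        "\<not> (u (c, 0) = u (c, 1) \<and> u (c, 1) = u (c, 2))"
      by argo+
  qed
  have "c \<notin> boundary E" for c
  proof
    assume b: "c \<in> boundary E"
    then have c: "c < ncr D" by (simp add: boundary_def)
    have "u (c, 0) \<noteq> (u (c, 1) \<noteq> ((\<not> u (c, 2)) \<noteq> (\<not> u (c, 3))))"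
      using b unfolding boundary_def mem_Collect_eq arcs[OF c] by (rule conjunct2)
    then show False using balanced(1)[OF c] by argo
  qed
  then have "boundary E = {}" by blast
  then obtain W where W: "E = coboundary W" using cycle_is_coboundary[of E] unfolding E_def by blast
  let ?f = "\<lambda>d. face d \<in> W"
  \<comment> \<open>The ends of forward arcs with their face in \<open>W\<close> are counted twice:
    crossing by crossing, where the transverse ones give the odd terms, and arc by arc.\<close>
  let ?Q = "\<lambda>d. arc d \<notin> E \<and> ?f d"
  have "odd (card {j. j < 4 \<and> ?Q (c, j)}) \<longleftrightarrow> c \<in> transverse u" if c: "c < ncr D" for c
  proof -
    have "arc (c, j) \<in> E \<longleftrightarrow> ?f (c, j) \<noteq> ?f (rot (c, j))" if "j < 4" for j
      unfolding W using that c by (intro arc_coboundary) (simp add: ports_def)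
    from this[of 0] this[of 1] this[of 2] this[of 3]
    have "arc (c, 0) \<in> E \<longleftrightarrow> ?f (c, 0) \<noteq> ?f (c, 1)" "arc (c, 1) \<in> E \<longleftrightarrow> ?f (c, 1) \<noteq> ?f (c, 2)"
       "arc (c, 2) \<in> E \<longleftrightarrow> ?f (c, 2) \<noteq> ?f (c, 3)" "arc (c, 3) \<in> E \<longleftrightarrow> ?f (c, 3) \<noteq> ?f (c, 0)"
      unfolding rot_simps by simp_all
    then have f: "u (c, 0) \<longleftrightarrow> ?f (c, 0) \<noteq> ?f (c, 1)" "u (c, 1) \<longleftrightarrow> ?f (c, 1) \<noteq> ?f (c, 2)"
       "u (c, 2) \<longleftrightarrow> ?f (c, 2) = ?f (c, 3)" "u (c, 3) \<longleftrightarrow> ?f (c, 3) = ?f (c, 0)"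
      unfolding arcs[OF c] by blast+
    \<comment> \<open>The colours of the four faces at the crossing determine \<open>u\<close> at
      all ports, so only the colourings have to be checked.\<close>
    show ?thesis
      unfolding odd_card_less4 transverse_def mem_Collect_eq arcs[OF c] f
      using balanced[OF c, unfolded f] c
      by (cases "?f (c, 0)"; cases "?f (c, 1)"; cases "?f (c, 2)"; cases "?f (c, 3)"; simp)
  qed
  then have tr: "transverse u = {c \<in> {..<ncr D}. odd (card {j. j < 4 \<and> ?Q (c, j)})}"
    unfolding transverse_def by blast
  let ?N = "{d \<in> ports D. ?Q d}"
  have "card ?N = (\<Sum>c<ncr D. card {j. j < 4 \<and> ?Q (c, j)})"
  proof -
    have "?N = (SIGMA c:{..<ncr D}. {j. j < 4 \<and> ?Q (c, j)})" by (auto simp: ports_def)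
    then show ?thesis by simp
  qed
  then have "even (card ?N) \<longleftrightarrow> even (card (transverse u))"
    unfolding tr by (simp only: even_sum_iff[OF finite_lessThan])
  moreover have "even (card ?N)"
  proof -
    let ?P = "{p \<in> outs D. ?Q p}"
    \<comment> \<open>The two sides of an arc outside \<open>E\<close> have the same colour, as
      \<open>E\<close> is the coboundary of \<open>W\<close>. So \<open>?N\<close> contains both
      ends of an arc or neither.\<close>
    have QN: "?Q (nxt D p) \<longleftrightarrow> ?Q p" if p: "p \<in> outs D" for p
    proof -
      have "p \<in> E \<longleftrightarrow> ?f p \<noteq> ?f (nxt D p)" unfolding W using p by (simp add: coboundary_def)
      then show ?thesis using p by (auto simp: arc_out arc_nxt)
    qed
    have "?N = ?P \<union> nxt D ` ?P"
    proof (intro equalityI subsetI)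
      fix d assume d: "d \<in> ?N"
      then have "d \<in> ports D" by simp
      then show "d \<in> ?P \<union> nxt D ` ?P"
      proof (cases rule: ports_cases)
        case inc
        then have "arcIn D d \<in> ?P" "d = nxt D (arcIn D d)"
          using QN[of "arcIn D d"] arcIn_outs[of d] nxt_arcIn[of d] d by auto
        then show ?thesis by blast
      qed (use d in blast)
    next
      fix d assume "d \<in> ?P \<union> nxt D ` ?P"
      then show "d \<in> ?N" using QN nxt_ins by (auto simp: ports_eq)
    qed
    moreover have "?P \<inter> nxt D ` ?P = {}" using nxt_ins outs_ins_disjoint by blast
    moreover have "card (nxt D ` ?P) = card ?P"
      using nxt_bij by (intro card_image) (auto simp: bij_betw_def intro: inj_on_subset)
    moreover have "finite ?P" using finite_outs by simp
    ultimately have "card ?N = 2 * card ?P" by (simp add: card_Un_disjoint)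
    then show ?thesis by simp
  qed
  ultimately show ?thesis by simp
qed

end

section \<open>Weight maps and the parity of a state\<close>

context diagram
begin

definition nonvirtual :: "nat set" where
  "nonvirtual = ccross D \<union> scross D"

lemma nonvirtual_iff: "c \<in> nonvirtual \<longleftrightarrow> c < ncr D \<and> ctyp D c \<noteq> Virtual"
  by (cases "ctyp D c") (auto simp: nonvirtual_def ccross_def scross_def)

lemma vcross_iff: "c \<in> vcross D \<longleftrightarrow> c < ncr D \<and> ctyp D c = Virtual"
  by (simp add: vcross_def)

lemma finite_nonvirtual: "finite nonvirtual"
  by (rule finite_subset[of _ "{..<ncr D}"]) (auto simp: nonvirtual_iff)

lemma states_iff: "T \<in> states D \<longleftrightarrow> T \<subseteq> nonvirtual"
  by (simp add: states_def nonvirtual_def)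

definition state_res :: "nat set \<Rightarrow> nat \<Rightarrow> nat" where
  "state_res T c = (if c \<in> T then 1 else if c \<in> nonvirtual then 3 else 2)"

lemma resolution_state_res: "resolution (state_res T)"
  by (simp add: resolution_def state_res_def)

text \<open>The traversal along the orientation of the diagram.\<close>

abbreviation u0 :: "nat \<times> nat \<Rightarrow> bool" where
  "u0 d \<equiv> d \<in> outs D"

lemma oriented_u0: "oriented u0"
  unfolding oriented_def
proof
  fix d assume "d \<in> ports D"
  then show "(alpha D d \<in> outs D) = (d \<notin> outs D)"
    using nxt_ins[of d] outs_ins_disjoint arcIn_outs[of d]
    by (cases rule: ports_cases) (simp_all add: alpha_out alpha_in, blast)
qed

text \<open>\<open>xor\<close> with 2 or 3 flips the bit that separates the incoming ports 0, 1 from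
  the outgoing ports 2, 3.\<close>

lemma compat_u0:
  assumes "\<And>c. m c = 2 \<or> m c = 3"
  shows "compat u0 m"
  unfolding compat_def
proof
  fix d assume "d \<in> ports D"
  then obtain c j where d: "d = (c, j)" "c < ncr D" "j < 4" by (auto simp: ports_def)
  then show "(res m d \<in> outs D) = (d \<notin> outs D)"
    using assms[of c] unfolding less4 by (auto simp: res_def outs_def)
qed

lemma ncomponents_loops: "ncomponents D = loops (\<lambda>_. 2) + ncirc D"
proof -
  let ?m = "\<lambda>_::nat. 2::nat"
  have "loops ?m = ncomp (outs D) {(p, step u0 ?m p) | p. p \<in> outs D}"
    by (intro loops_eq_cycles oriented_u0 compat_u0) (simp_all add: resolution_def)
  moreover have st: "step u0 ?m p = (fst (nxt D p), snd (nxt D p) + 2)" if p: "p \<in> outs D" for p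
  proof -
    obtain c j where cj: "nxt D p = (c, j)" "c < ncr D" "j = 0 \<or> j = 1"
      using nxt_ins[OF p] by (auto simp: ins_def)
    then have "res ?m (nxt D p) = (c, j + 2)" by (auto simp: res_def)
    moreover have "(c, j + 2) \<in> outs D" using cj by (auto simp: outs_def)
    ultimately show ?thesis using p cj by (simp add: step_def head_def arc_out)
  qed
  have "{(p, step u0 ?m p) | p. p \<in> outs D}
      = {(p, q). p \<in> outs D \<and> q = (fst (nxt D p), snd (nxt D p) + 2)}"
    using st by auto
  ultimately show ?thesis unfolding ncomponents_def by simp
qed

lemma edgeRel_loop:
  assumes d: "d \<in> ins D" "fst d \<notin> T"
  shows "(arc d, arc (res (state_res T) d)) \<in> edgeRel D T"
proof -
  obtain c j where cj: "d = (c, j)" "c < ncr D" "j = 0 \<or> j = 1" using d by (auto simp: ins_def)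
  have r: "res (state_res T) d = (c, through D c j)"
    using cj d(2) by (auto simp: res_def state_res_def through_def nonvirtual_iff)
  have "(c, through D c j) \<in> outs D" using cj by (auto simp: through_def outs_def)
  then show ?thesis
    using cj d arcIn_outs[OF d(1)] nxt_arcIn[OF d(1)] unfolding r by (simp add: edgeRel_def arc_in arc_out)
qed

lemma vertRel_loop:
  assumes "c \<in> T" "c < ncr D"
  shows "(arc (c, 0), arc (res (state_res T) (c, 0))) \<in> vertRel D T"
    and "(arc (c, 2), arc (res (state_res T) (c, 2))) \<in> vertRel D T"
proof -
  have "(c, 0) \<in> ins D" "(c, 1) \<in> ins D" "(c, 2) \<in> outs D" "(c, 3) \<in> outs D"
    using assms(2) by (auto simp: ins_def outs_def)
  moreover have "res (state_res T) (c, 0) = (c, 1)" "res (state_res T) (c, 2) = (c, 3)"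
    using assms(1) by (simp_all add: res_def state_res_def)
  ultimately show "(arc (c, 0), arc (res (state_res T) (c, 0))) \<in> vertRel D T"
    and "(arc (c, 2), arc (res (state_res T) (c, 2))) \<in> vertRel D T"
    using assms(1) by (auto simp: vertRel_def arc_in arc_out)
qed

text \<open>Every junction of \<open>state_res T\<close> occurs in \<open>edgeRel\<close> or
  \<open>vertRel\<close> in at least one direction, and these contain no other pairs.\<close>

lemma ncurves_loops:
  assumes T: "T \<subseteq> nonvirtual"
  shows "ncurves D T = loops (state_res T) + ncirc D"
proof -
  let ?m = "state_res T"
  let ?A = "{(arc d, arc (res ?m d)) | d. d \<in> ports D}"
  let ?R = "edgeRel D T \<union> vertRel D T"
  have TD: "c < ncr D" if "c \<in> T" for c using T that nonvirtual_iff by blast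
  have A: "(arc d, arc (res ?m d)) \<in> ?A \<and> (arc (res ?m d), arc d) \<in> ?A" if d: "d \<in> ports D" for d
  proof
    show "(arc d, arc (res ?m d)) \<in> ?A" using d by blast
    show "(arc (res ?m d), arc d) \<in> ?A"
      using res_ports(1,3)[OF resolution_state_res d] by (intro CollectI exI[of _ "res ?m d"]) simp
  qed
  have RA: "(p, q) \<in> ?A" if "(p, q) \<in> ?R" for p q
    using that
  proof
    assume e: "(p, q) \<in> edgeRel D T"
    then have p: "p \<in> outs D" "fst (nxt D p) \<notin> T"
      and q: "q = (fst (nxt D p), through D (fst (nxt D p)) (snd (nxt D p)))"
      by (auto simp: edgeRel_def)
    have n: "nxt D p \<in> ins D" using p by (simp add: nxt_ins)
    have "(p, arc (res ?m (nxt D p))) \<in> edgeRel D T"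
      using edgeRel_loop[OF n p(2)] arc_nxt[OF p(1)] by simp
    then have "q = arc (res ?m (nxt D p))" using q by (simp add: edgeRel_def)
    then show ?thesis using A[of "nxt D p"] n arc_nxt[OF p(1)] by (simp add: ports_eq)
  next
    assume "(p, q) \<in> vertRel D T"
    then obtain c where c: "c \<in> T"
      and pq: "(p, q) = (arcIn D (c, 0), arcIn D (c, 1)) \<or> (p, q) = ((c, 2), (c, 3))"
      by (auto simp: vertRel_def)
    have P: "(c, 0) \<in> ports D" "(c, 2) \<in> ports D" "(c, 0) \<in> ins D" "(c, 1) \<in> ins D"
      "(c, 2) \<in> outs D" "(c, 3) \<in> outs D"
      using TD[OF c] by (auto simp: ins_def outs_def ports_def)
    have r: "res ?m (c, 0) = (c, 1)" "res ?m (c, 2) = (c, 3)"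
      using c by (simp_all add: res_def state_res_def)
    have "(arcIn D (c, 0), arcIn D (c, 1)) \<in> ?A"
      using A[OF P(1)] unfolding r arc_in[OF P(3)] arc_in[OF P(4)] by (rule conjunct1)
    moreover have "((c, 2), (c, 3)) \<in> ?A"
      using A[OF P(2)] unfolding r arc_out[OF P(5)] arc_out[OF P(6)] by (rule conjunct1)
    ultimately show ?thesis using pq by (elim disjE ssubst)
  qed
  have Asym: "(y, x) \<in> ?A" if xy: "(x, y) \<in> ?A" for x y
  proof -
    have "\<exists>d. (x, y) = (arc d, arc (res ?m d)) \<and> d \<in> ports D" using xy by (rule CollectD)
    then obtain d where d: "(x, y) = (arc d, arc (res ?m d))" "d \<in> ports D" by (elim exE conjE)
    then have xy: "x = arc d" "y = arc (res ?m d)" by simp_all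
    show ?thesis using A[OF d(2)] unfolding xy by (rule conjunct2)
  qed
  have AR: "(arc d, arc (res ?m d)) \<in> ?R \<union> ?R\<inverse>" if d: "d \<in> ports D" for d
  proof (cases "fst d \<in> T")
    case True
    obtain c j where cj: "d = (c, j)" "c < ncr D" "j < 4" using d by (auto simp: ports_def)
    then have c: "c \<in> T" using True by simp
    have r: "res ?m (c, 1) = (c, 0)" "res ?m (c, 3) = (c, 2)"
      "res ?m (c, 0) = (c, 1)" "res ?m (c, 2) = (c, 3)"
      using c by (simp_all add: res_def state_res_def)
    note V = vertRel_loop[OF c cj(2), unfolded r]
    consider "j = 0" | "j = 1" | "j = 2" | "j = 3" using cj(3) unfolding less4 by blast
    then show ?thesis
      by cases (use V r cj(1) in \<open>simp_all\<close>)
  next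
    case False
    have R: "res ?m d \<in> ports D" "res ?m (res ?m d) = d" "fst (res ?m d) = fst d"
      using res_ports[OF resolution_state_res d] by (simp_all add: res_def)
    show ?thesis using d
    proof (cases rule: ports_cases)
      case inc
      then show ?thesis using edgeRel_loop[of d T] False by blast
    next
      case out
      moreover have "state_res T (fst d) = 2 \<or> state_res T (fst d) = 3"
        using False by (simp add: state_res_def)
      ultimately have "res ?m d \<in> ins D" by (auto simp: res_def outs_def ins_def)
      then have "(arc (res ?m d), arc d) \<in> edgeRel D T"
        using edgeRel_loop[of "res ?m d" T] False R by simp
      then show ?thesis by blast
    qed
  qed
  have "?R \<union> ?R\<inverse> = ?A \<union> ?A\<inverse>"
  proof (intro equalityI subsetI)
    fix z assume "z \<in> ?R \<union> ?R\<inverse>"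
    then show "z \<in> ?A \<union> ?A\<inverse>" using RA by (cases z) blast
  next
    fix z assume "z \<in> ?A \<union> ?A\<inverse>"
    then have "z \<in> ?A" using Asym by (cases z) blast
    then show "z \<in> ?R \<union> ?R\<inverse>" using AR by blast
  qed
  then show ?thesis unfolding ncurves_def loops_def ncomp_def by simp
qed

text \<open>Arcs of weight 1 are run through forwards, the others backwards; the condition is
  negated at the end of an arc, where a forward traversal arrives.\<close>

definition traversal :: "(nat \<times> nat \<Rightarrow> int) \<Rightarrow> nat \<times> nat \<Rightarrow> bool" where
  "traversal \<tau> d \<longleftrightarrow> (if d \<in> outs D then \<tau> d = 1 else \<tau> (arcIn D d) \<noteq> 1)"

lemma traversal_arc:
  "d \<in> ports D \<Longrightarrow> traversal \<tau> d \<longleftrightarrow> (d \<in> outs D \<longleftrightarrow> \<tau> (arc d) = 1)"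
  by (auto simp: traversal_def arc_def)

text \<open>Along an edge the weight is kept and an incoming port meets an outgoing one; at a vertex
  the weight changes and two ports of the same kind meet. In both cases the traversal passes
  on.\<close>

lemma traversal_weight_map:
  assumes T: "T \<subseteq> nonvirtual" and w: "weight_map D T \<tau>"
  shows "oriented (traversal \<tau>)" "compat (traversal \<tau>) (state_res T)"
proof -
  have pm: "\<tau> (arc d) = 1 \<or> \<tau> (arc d) = -1" if "d \<in> ports D" for d
    using w arc_outs[OF that] unfolding weight_map_def by blast
  have e: "\<tau> p = \<tau> q" if "(p, q) \<in> edgeRel D T" for p q
    using w that unfolding weight_map_def by blast
  have v: "\<tau> p \<noteq> \<tau> q" if "(p, q) \<in> vertRel D T" for p q
    using w that unfolding weight_map_def by blast
  show "oriented (traversal \<tau>)" unfolding oriented_def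
  proof
    fix d assume d: "d \<in> ports D"
    then show "traversal \<tau> (alpha D d) = (\<not> traversal \<tau> d)"
      using oriented_u0 alpha_props[OF d] by (auto simp: traversal_arc oriented_def)
  qed
  let ?m = "state_res T"
  \<comment> \<open>One port of each joined pair suffices, since \<open>res\<close> is an
    involution.\<close>
  have half: "traversal \<tau> (res ?m d) = (\<not> traversal \<tau> d)"
    if d: "d \<in> ports D" "d \<in> ins D \<or> fst d \<in> T \<and> snd d = 2" "fst d \<in> T \<Longrightarrow> snd d \<noteq> 1" for d
  proof (cases "fst d \<in> T")
    case False
    then have di: "d \<in> ins D" using d by blast
    have "\<tau> (arc d) = \<tau> (arc (res ?m d))" using e edgeRel_loop[OF di False] by blast
    moreover have "state_res T (fst d) = 2 \<or> state_res T (fst d) = 3"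
      using False by (simp add: state_res_def)
    then have "res ?m d \<in> outs D" using di by (auto simp: res_def outs_def ins_def)
    ultimately show ?thesis
      using d(1) di outs_ins_disjoint[of d] res_ports(1)[OF resolution_state_res d(1), of T]
      by (simp add: traversal_arc) blast
  next
    case True
    obtain c where c: "c \<in> T" "c < ncr D" and dc: "d = (c, 0) \<or> d = (c, 2)"
      using True d by (cases d) (auto simp: ins_def ports_def)
    then have "\<tau> (arc d) \<noteq> \<tau> (arc (res ?m d))" using v vertRel_loop[OF c] by metis
    moreover have "d \<in> outs D \<longleftrightarrow> res ?m d \<in> outs D"
      using dc c by (auto simp: outs_def res_def state_res_def)
    moreover have R: "res ?m d \<in> ports D" using res_ports(1)[OF resolution_state_res d(1)] .
    ultimately show ?thesis
      using d(1) pm[OF d(1)] pm[OF R] by (auto simp: traversal_arc)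
  qed
  show "compat (traversal \<tau>) ?m" unfolding compat_def
  proof
    fix d assume d: "d \<in> ports D"
    note R = res_ports(1,3)[OF resolution_state_res d, of T]
    have "(d \<in> ins D \<or> fst d \<in> T \<and> snd d = 2) \<and> (fst d \<in> T \<longrightarrow> snd d \<noteq> 1)
       \<or> (res ?m d \<in> ins D \<or> fst (res ?m d) \<in> T \<and> snd (res ?m d) = 2) \<and> (fst (res ?m d) \<in> T \<longrightarrow> snd (res ?m d) \<noteq> 1)"
    proof -
      obtain c j where cj: "d = (c, j)" "c < ncr D" "j < 4" using d by (auto simp: ports_def)
      then show ?thesis unfolding less4 by (auto simp: res_def state_res_def ins_def)
    qed
    then show "traversal \<tau> (res ?m d) = (\<not> traversal \<tau> d)"
      using half[OF d] half[OF R(1)] R(2) by auto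
  qed
qed

text \<open>Colouring the ports alternately under \<open>alpha\<close> and \<open>res\<close>
  orients every curve of the state, and the weight records whether this agrees with the diagram.
  Existence makes the choice by \<open>SOME\<close> in \<open>iS\<close> meaningful.\<close>

lemma weight_map_exists:
  assumes T: "T \<subseteq> nonvirtual"
  shows "\<exists>\<tau>. weight_map D T \<tau>"
proof -
  let ?m = "state_res T"
  have "\<exists>u. \<forall>d\<in>ports D. u (alpha D d) = (\<not> u d) \<and> u (res ?m d) = (\<not> u d)"
    using alpha_props res_ports[OF resolution_state_res]
    by (intro two_colouring_involutions finite_ports) auto
  then obtain u where u: "\<And>d. d \<in> ports D \<Longrightarrow> u (alpha D d) = (\<not> u d)"
    "\<And>d. d \<in> ports D \<Longrightarrow> u (res ?m d) = (\<not> u d)" by blast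
  let ?t = "\<lambda>p. if u p then 1 else - 1 :: int"
  have ua: "u (arc d) = (if d \<in> outs D then u d else \<not> u d)" if "d \<in> ports D" for d
    using that u(1)[OF that] by (cases rule: ports_cases) (simp_all add: arc_out arc_in alpha_in)
  have "?t p = ?t q" if e: "(p, q) \<in> edgeRel D T" for p q
  proof -
    have p: "p \<in> outs D" "fst (nxt D p) \<notin> T"
      and q: "q = (fst (nxt D p), through D (fst (nxt D p)) (snd (nxt D p)))"
      using e by (auto simp: edgeRel_def)
    have n: "nxt D p \<in> ins D" "nxt D p \<in> ports D" using p nxt_ins[of p] by (simp_all add: ports_eq)
    have "(p, arc (res ?m (nxt D p))) \<in> edgeRel D T"
      using edgeRel_loop[OF n(1) p(2)] arc_nxt[OF p(1)] by simp
    then have q': "q = arc (res ?m (nxt D p))" using q by (simp add: edgeRel_def)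
    have "state_res T (fst (nxt D p)) = 2 \<or> state_res T (fst (nxt D p)) = 3"
      using p by (simp add: state_res_def)
    then have "res ?m (nxt D p) \<in> outs D" using n by (auto simp: res_def outs_def ins_def)
    then have "u q = (\<not> u (nxt D p))" using q' u(2)[OF n(2)] by (simp add: arc_out)
    also have "\<dots> = u p" using ua[OF n(2)] outs_ins_disjoint[of "nxt D p"] n(1) p(1) by (auto simp: arc_nxt)
    finally show ?thesis by simp
  qed
  moreover have "?t p \<noteq> ?t q" if e: "(p, q) \<in> vertRel D T" for p q
  proof -
    obtain c where c: "c \<in> T"
      and pq: "(p, q) = (arcIn D (c, 0), arcIn D (c, 1)) \<or> (p, q) = ((c, 2), (c, 3))"
      using e by (auto simp: vertRel_def)
    have "c < ncr D" using c T nonvirtual_iff by blast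
    then have P: "(c, 0) \<in> ports D" "(c, 1) \<in> ports D" "(c, 2) \<in> ports D" "(c, 0) \<in> ins D" "(c, 1) \<in> ins D"
      "(c, 0) \<notin> outs D" "(c, 1) \<notin> outs D"
      by (auto simp: ins_def outs_def ports_def)
    have r: "res ?m (c, 0) = (c, 1)" "res ?m (c, 2) = (c, 3)"
      using c by (simp_all add: res_def state_res_def)
    have "u (c, 3) = (\<not> u (c, 2))" "u (c, 1) = (\<not> u (c, 0))"
      using u(2)[OF P(1)] u(2)[OF P(3)] unfolding r by simp_all
    moreover have "u (arcIn D (c, 0)) = (\<not> u (c, 0))" "u (arcIn D (c, 1)) = (\<not> u (c, 1))"
      using ua[OF P(1)] ua[OF P(2)] P unfolding arc_in[OF P(4)] arc_in[OF P(5)] by simp_all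
    ultimately show ?thesis using pq by auto
  qed
  moreover have "?t p = 1 \<or> ?t p = -1" for p by simp
  ultimately have "weight_map D T ?t" unfolding weight_map_def by blast
  then show ?thesis by blast
qed

end

section \<open>The sign of a state as a parity\<close>

context planar_diagram
begin

text \<open>The left side counts transverse virtual crossings; two changes of resolution express the
  right side through transverse disoriented ones. Oriented crossings are never transverse, so
  \<open>even_transverse\<close> equates the two parities.\<close>

lemma iS_parity:
  assumes T: "T \<subseteq> nonvirtual"
  shows "iS D T = (-1) ^ (ncurves D T + ncomponents D + card (nonvirtual - T))"
proof -
  let ?m = "state_res T"
  define \<tau> where "\<tau> = (SOME \<tau>. weight_map D T \<tau>)"
  have w: "weight_map D T \<tau>" unfolding \<tau>_def using weight_map_exists[OF T] by (rule someI_ex)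
  let ?u = "traversal \<tau>"
  note u = traversal_weight_map[OF T w]
  let ?tr = "transverse ?u"
  have x: "?u (c, xor j (?m c)) = (\<not> ?u (c, j))" if "c < ncr D" "j < 4" for c j
    using bspec[OF u(2)[unfolded compat_def], of "(c, j)"] that by (simp add: ports_def res_def)
  have x1: "?u (c, 1) = (\<not> ?u (c, 0))" "?u (c, 3) = (\<not> ?u (c, 2))" if c: "c \<in> T" for c
  proof -
    have "c < ncr D" using c T nonvirtual_iff by blast
    moreover have "?m c = 1" using c by (simp add: state_res_def)
    ultimately show "?u (c, 1) = (\<not> ?u (c, 0))" "?u (c, 3) = (\<not> ?u (c, 2))"
      using x[of c 0] x[of c 2] by simp_all
  qed
  have x2: "?u (c, 2) = (\<not> ?u (c, 0))" "?u (c, 3) = (\<not> ?u (c, 1))" if c: "c \<in> vcross D" for c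
  proof -
    have "c \<notin> T" "c < ncr D" "c \<notin> nonvirtual"
      using c T nonvirtual_iff[of c] by (auto simp: vcross_iff)
    moreover from this have "?m c = 2" by (simp add: state_res_def)
    ultimately show "?u (c, 2) = (\<not> ?u (c, 0))" "?u (c, 3) = (\<not> ?u (c, 1))"
      using x[of c 0] x[of c 1] by simp_all
  qed
  have x3: "?u (c, 3) = (\<not> ?u (c, 0))" "?u (c, 2) = (\<not> ?u (c, 1))" if c: "c \<in> nonvirtual - T" for c
  proof -
    have "c < ncr D" using c nonvirtual_iff by blast
    moreover have "?m c = 3" using c by (simp add: state_res_def)
    ultimately show "?u (c, 3) = (\<not> ?u (c, 0))" "?u (c, 2) = (\<not> ?u (c, 1))"
      using x[of c 0] x[of c 1] by simp_all
  qed
  have fT: "finite T" using T finite_nonvirtual by (rule finite_subset)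
  have ftr: "finite ?tr" unfolding transverse_def by simp

  have "iS D T = (\<Prod>c\<in>vcross D. \<tau> (arcIn D (c, 0)) * \<tau> (arcIn D (c, 1)))"
    unfolding iS_def Let_def \<tau>_def ..
  also have "\<dots> = (\<Prod>c\<in>vcross D. if c \<in> ?tr then -1 else 1)"
  proof (rule prod.cong[OF refl])
    fix c assume c: "c \<in> vcross D"
    then have "c < ncr D" by (simp add: vcross_iff)
    then have P: "(c, 0) \<in> ins D" "(c, 1) \<in> ins D" "(c, 0) \<notin> outs D" "(c, 1) \<notin> outs D"
      by (auto simp: ins_def outs_def)
    have pm: "\<tau> (arcIn D q) = 1 \<or> \<tau> (arcIn D q) = -1" if "q \<in> ins D" for q
      using w arcIn_outs[OF that] unfolding weight_map_def by blast
    \<comment> \<open>At a virtual crossing both strands run straight through, so transverse just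
      means that the two weights differ.\<close>
    have "c \<in> ?tr \<longleftrightarrow> ?u (c, 0) \<noteq> ?u (c, 1)"
      using x2[OF c] \<open>c < ncr D\<close> unfolding transverse_def by simp
    then have "c \<in> ?tr \<longleftrightarrow> (\<tau> (arcIn D (c, 0)) = 1) \<noteq> (\<tau> (arcIn D (c, 1)) = 1)"
      unfolding traversal_def using P by simp
    then show "\<tau> (arcIn D (c, 0)) * \<tau> (arcIn D (c, 1)) = (if c \<in> ?tr then -1 else 1)"
      using pm[OF P(1)] pm[OF P(2)] by auto
  qed
  also have "\<dots> = (-1) ^ card (?tr \<inter> vcross D)"
  proof -
    have "finite (vcross D)" unfolding vcross_def by simp
    then show ?thesis by (simp add: prod.If_cases Int_commute)
  qed
  finally have i: "iS D T = (-1) ^ card (?tr \<inter> vcross D)" .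

  \<comment> \<open>\<open>mZ\<close> is oriented on \<open>C\<close> and straight elsewhere.
    Transverse disoriented crossings stay straight, which makes \<open>mZ\<close> compatible with
    \<open>u0\<close> as well as with \<open>?u\<close>.\<close>
  define C where "C = nonvirtual - (T \<inter> ?tr)"
  define mZ where "mZ = (\<lambda>c. if c \<in> C then 3 else 2 :: nat)"
  have Z: "resolution mZ" "mZ c = 2 \<or> mZ c = 3" for c by (simp_all add: mZ_def resolution_def)
  have Cn: "C \<subseteq> {..<ncr D}" "finite C" using finite_nonvirtual unfolding C_def by (auto simp: nonvirtual_iff)
  have uZ: "compat ?u mZ" unfolding compat_def
  proof
    fix d assume d: "d \<in> ports D"
    obtain c j where cj: "d = (c, j)" "c < ncr D" "j < 4" using d by (auto simp: ports_def)
    show "?u (res mZ d) = (\<not> ?u d)"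
    proof (cases "c \<in> T")
      case False
      then have "mZ c = ?m c" by (simp add: mZ_def C_def state_res_def)
      then show ?thesis using x[OF cj(2,3)] cj by (simp add: res_def)
    next
      case True
      show ?thesis
      proof (cases "c \<in> ?tr")
        case tr: True
        then have "mZ c = 2" using True by (simp add: mZ_def C_def)
        moreover have "?u (c, 2) = (\<not> ?u (c, 0))" "?u (c, 3) = (\<not> ?u (c, 1))"
          using tr by (simp_all add: transverse_def)
        ultimately show ?thesis using cj unfolding less4 by (auto simp: res_def)
      next
        \<comment> \<open>With ports 0, 1 and ports 2, 3 opposite, failing to be transverse forces
          ports 0 and 2 to agree, so the oriented pairing fits.\<close>
        case tr: False
        then have "mZ c = 3" using True T by (auto simp: mZ_def C_def)
        moreover have "?u (c, 3) = (\<not> ?u (c, 0))" "?u (c, 2) = (\<not> ?u (c, 1))"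
          using tr x1[OF True] cj(2) by (auto simp: transverse_def)
        ultimately show ?thesis using cj unfolding less4 by (auto simp: res_def)
      qed
    qed
  qed
  have "even (loops mZ) \<longleftrightarrow> even (loops (\<lambda>_. 2) + card C)"
    by (rule loops_change[OF oriented_u0 _ compat_u0 Cn(2,1) Z(1) compat_u0[OF Z(2)]])
      (simp_all add: resolution_def mZ_def)
  moreover have "even (loops ?m) \<longleftrightarrow> even (loops mZ + card T)"
  proof (rule loops_change[OF u(1) Z(1) uZ fT _ resolution_state_res u(2)])
    show "T \<subseteq> {..<ncr D}" using T nonvirtual_iff by auto
    show "?m c \<noteq> mZ c" if "c \<in> T" for c using that Z(2)[of c] by (auto simp: state_res_def)
    show "?m c = mZ c" if "c \<notin> T" for c using that by (simp add: mZ_def C_def state_res_def)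
  qed
  moreover have "card C + card (T \<inter> ?tr) = card (nonvirtual - T) + card T"
  proof -
    have "card C = card nonvirtual - card (T \<inter> ?tr)"
      unfolding C_def using T fT by (intro card_Diff_subset) auto
    moreover have "card (nonvirtual - T) = card nonvirtual - card T"
      using T fT by (intro card_Diff_subset) auto
    moreover have "card (T \<inter> ?tr) \<le> card nonvirtual" "card T \<le> card nonvirtual"
      using T by (auto intro!: card_mono finite_nonvirtual)
    ultimately show ?thesis by simp
  qed
  moreover have "card ?tr = card (T \<inter> ?tr) + card (?tr \<inter> vcross D)"
  proof -
    have "c \<in> T \<or> c \<in> vcross D" if c: "c \<in> ?tr" for c
    proof (rule ccontr)
      assume "\<not> ?thesis"
      moreover have "c < ncr D" using c by (simp add: transverse_def)
      ultimately have "c \<in> nonvirtual - T" by (simp add: nonvirtual_iff vcross_iff)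
      note x3[OF this]
      moreover have "?u (c, 2) = (\<not> ?u (c, 0))" "?u (c, 0) \<noteq> ?u (c, 1)"
        using c by (simp_all add: transverse_def)
      ultimately show False by argo
    qed
    then have "?tr = (T \<inter> ?tr) \<union> (?tr \<inter> vcross D)" by (intro set_eqI) auto
    moreover have "(T \<inter> ?tr) \<inter> (?tr \<inter> vcross D) = {}"
      using T by (auto simp: nonvirtual_iff vcross_iff)
    ultimately show ?thesis using ftr by (metis card_Un_disjoint finite_Int)
  qed
  moreover have "even (card ?tr)"
    by (rule even_transverse[OF u(1) resolution_state_res u(2)])
  \<comment> \<open>The bookkeeping in plain numbers: \<open>z\<close>, \<open>l\<close>,
    \<open>l2\<close> are the loops of \<open>mZ\<close>, \<open>?m\<close> and the straight
    resolution, the other letters the cardinalities above.\<close>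
  moreover have "even v \<longleftrightarrow> even (l + l2 + y)"
    if "even z \<longleftrightarrow> even (l2 + k)" "even l \<longleftrightarrow> even (z + t)" "k + x = y + t" "r = x + v" "even r"
    for z l2 k l t x y r v :: nat
    using that by presburger
  ultimately have "even (card (?tr \<inter> vcross D)) \<longleftrightarrow> even (loops ?m + loops (\<lambda>_. 2) + card (nonvirtual - T))"
    by blast
  then have "even (card (?tr \<inter> vcross D))
      \<longleftrightarrow> even (ncurves D T + ncomponents D + card (nonvirtual - T))"
    unfolding ncurves_loops[OF T] ncomponents_loops by auto
  then show ?thesis unfolding i by (simp add: minus_one_power_iff)
qed

end

section \<open>Exponents modulo 4\<close>

lemma Apow_conv_shift: "Apow m = fls_shift (- m) 1"
  by (auto simp: Apow_def fls_X_power_conv_shift_1 fls_X_inv_power_conv_shift_1)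

lemma nth_times_Apow: "fls_nth (f * Apow m) n = fls_nth f (n - m)"
  by (simp add: Apow_conv_shift fls_X_intpow_times_conv_shift)

text \<open>Multiplying by a power of \<open>A\<close> shifts the support, so membership is a
  condition on the support alone, from which sums and changes of \<open>m\<close> modulo 4 are
  easy.\<close>

lemma in_ZA4_times_iff:
  "in_ZA4_times m f \<longleftrightarrow> finite {n. fls_nth f n \<noteq> 0} \<and> (\<forall>n. fls_nth f n \<noteq> 0 \<longrightarrow> 4 dvd n - m)"
  (is "_ \<longleftrightarrow> ?R")
proof
  assume "in_ZA4_times m f"
  then obtain g where g: "finite {n. fls_nth g n \<noteq> 0}" "\<forall>n. fls_nth g n \<noteq> 0 \<longrightarrow> 4 dvd n" "f = g * Apow m"
    by (auto simp: in_ZA4_times_def)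
  have "{n. fls_nth f n \<noteq> 0} \<subseteq> (\<lambda>n. n + m) ` {n. fls_nth g n \<noteq> 0}"
    unfolding g(3) by (auto simp: nth_times_Apow intro!: image_eqI[of _ _ "_ - m"])
  with g(1) have "finite {n. fls_nth f n \<noteq> 0}" by (rule finite_surj)
  then show ?R using g(2) by (simp add: g(3) nth_times_Apow)
next
  assume R: ?R
  let ?g = "f * Apow (- m)"
  have "{n. fls_nth ?g n \<noteq> 0} \<subseteq> (\<lambda>n. n - m) ` {n. fls_nth f n \<noteq> 0}"
    by (auto simp: nth_times_Apow intro!: image_eqI[of _ _ "_ + m"])
  then have "finite {n. fls_nth ?g n \<noteq> 0}" using finite_surj R by blast
  moreover have "4 dvd n" if "fls_nth ?g n \<noteq> 0" for n
    using R that by (force simp: nth_times_Apow)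
  moreover have "f = ?g * Apow m" by (rule fls_eqI) (simp add: nth_times_Apow)
  ultimately show "in_ZA4_times m f" unfolding in_ZA4_times_def by blast
qed

lemma in_ZA4_times_cong: "in_ZA4_times m f \<Longrightarrow> 4 dvd m - m' \<Longrightarrow> in_ZA4_times m' f"
  unfolding in_ZA4_times_iff by (metis dvd_add diff_add_cancel add_diff_eq)

lemma in_ZA4_times_0: "in_ZA4_times m 0"
  by (simp add: in_ZA4_times_iff)

lemma in_ZA4_times_uminus: "in_ZA4_times m f \<Longrightarrow> in_ZA4_times m (- f)"
  by (simp add: in_ZA4_times_iff)

lemma in_ZA4_times_add:
  assumes "in_ZA4_times m f" "in_ZA4_times m g"
  shows "in_ZA4_times m (f + g)"
proof -
  have "{n. fls_nth (f + g) n \<noteq> 0} \<subseteq> {n. fls_nth f n \<noteq> 0} \<union> {n. fls_nth g n \<noteq> 0}" by auto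
  moreover have "finite ({n. fls_nth f n \<noteq> 0} \<union> {n. fls_nth g n \<noteq> 0})"
    using assms by (simp add: in_ZA4_times_iff)
  ultimately have "finite {n. fls_nth (f + g) n \<noteq> 0}" by (rule finite_subset)
  moreover have "4 dvd n - m" if "fls_nth (f + g) n \<noteq> 0" for n
  proof -
    have "fls_nth f n \<noteq> 0 \<or> fls_nth g n \<noteq> 0" using that by auto
    then show ?thesis using assms unfolding in_ZA4_times_iff by blast
  qed
  ultimately show ?thesis unfolding in_ZA4_times_iff by blast
qed

lemma in_ZA4_times_sum: "(\<And>x. x \<in> X \<Longrightarrow> in_ZA4_times m (f x)) \<Longrightarrow> in_ZA4_times m (sum f X)"
  by (induction X rule: infinite_finite_induct) (simp_all add: in_ZA4_times_0 in_ZA4_times_add)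

lemma in_ZA4_times_Apow: "in_ZA4_times m (Apow m)"
proof -
  have "fls_nth (Apow m) n = (if n = m then 1 else 0)" for n
    by (simp add: Apow_conv_shift)
  then show ?thesis by (simp add: in_ZA4_times_iff)
qed

lemma in_ZA4_times_mult_Apow:
  assumes "in_ZA4_times m f"
  shows "in_ZA4_times (m + j) (f * Apow j)"
proof -
  obtain g where g: "finite {n. fls_nth g n \<noteq> 0}" "\<forall>n. fls_nth g n \<noteq> 0 \<longrightarrow> 4 dvd n" "f = g * Apow m"
    using assms by (auto simp: in_ZA4_times_def)
  have "f * Apow j = g * Apow (m + j)"
    unfolding g(3) by (rule fls_eqI) (simp only: nth_times_Apow diff_diff_eq add.commute)
  with g(1,2) show ?thesis unfolding in_ZA4_times_def by blast
qed

text \<open>The exponents \<open>j\<close> and \<open>- j\<close> differ by \<open>2 * j\<close>,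
  hence agree modulo 4; the cases of interest are 2 and 4.\<close>

lemma in_ZA4_times_mult_sym:
  assumes "in_ZA4_times m f" "4 dvd 2 * j"
  shows "in_ZA4_times (m + j) (f * (- Apow j - Apow (- j)))"
proof -
  have "in_ZA4_times (m + j) (f * Apow (- j))"
    by (rule in_ZA4_times_cong[OF in_ZA4_times_mult_Apow[OF assms(1), of "- j"]])
      (use assms(2) in presburger)
  with in_ZA4_times_mult_Apow[OF assms(1), of j]
  have "in_ZA4_times (m + j) (- (f * Apow j + f * Apow (- j)))"
    by (intro in_ZA4_times_uminus in_ZA4_times_add)
  then show ?thesis by (simp add: algebra_simps)
qed

lemma in_ZA4_times_mult_sym_power:
  assumes "in_ZA4_times m f" "4 dvd 2 * j"
  shows "in_ZA4_times (m + int n * j) (f * (- Apow j - Apow (- j)) ^ n)"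
proof (induction n)
  case (Suc n)
  from in_ZA4_times_mult_sym[OF Suc assms(2)] show ?case
    by (simp add: algebra_simps)
qed (use assms in simp)

text \<open>Modulo 4 the contributions of \<open>bS\<close> and \<open>betaS\<close> to the exponent
  vanish, and each factor for \<open>alphaS\<close> and \<open>ncurves\<close> adds 2.\<close>

lemma Rbar_in_ZA4_times:
  assumes "4 dvd 2 * (aS D T + int (alphaS D T) + int (ncurves D T)) - m"
  shows "in_ZA4_times m (Rbar D T)"
proof -
  have "in_ZA4_times (2 * aS D T + 4 * bS D T + int (alphaS D T + ncurves D T) * 2 + int (betaS D T) * 4) (Rbar D T)"
    unfolding Rbar_def
    by (intro in_ZA4_times_mult_sym_power in_ZA4_times_Apow) simp_all
  then show ?thesis
    by (rule in_ZA4_times_cong) (use assms in presburger)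
qed

section \<open>From parities of states to the coefficients of the invariant\<close>

context planar_diagram
begin

text \<open>Modulo 2 the difference in \<open>aS\<close> is a sum, so both sides count all oriented
  resolutions.\<close>

lemma aS_alphaS_parity:
  "even (aS D T + int (alphaS D T)) \<longleftrightarrow> even (card (nonvirtual - T))"
proof -
  have fin: "finite (neg_cross D - T)" "finite (pos_cross D - T)" "finite (scross D - T)"
    by (simp_all add: neg_cross_def pos_cross_def scross_def)
  have "nonvirtual - T = (neg_cross D - T) \<union> ((pos_cross D - T) \<union> (scross D - T))"
    by (auto simp: nonvirtual_def ccross_def neg_cross_def pos_cross_def scross_def)
  moreover have "(neg_cross D - T) \<inter> ((pos_cross D - T) \<union> (scross D - T)) = {}"
     "(pos_cross D - T) \<inter> (scross D - T) = {}"
    by (auto simp: neg_cross_def pos_cross_def scross_def)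
  ultimately have "card (nonvirtual - T)
      = card (neg_cross D - T) + (card (pos_cross D - T) + card (scross D - T))"
    using fin by (simp add: card_Un_disjoint)
  then show ?thesis unfolding aS_def alphaS_def by simp argo
qed

text \<open>By \<open>iS_parity\<close> the sign fixes the parity of oriented resolutions plus
  curves relative to the number of components; doubling turns this into a congruence of exponents
  modulo 4.\<close>

lemma Rbar_state:
  assumes T: "T \<in> states D"
  shows "iS D T = 1 \<or> iS D T = -1"
    and "iS D T = 1 \<Longrightarrow> in_ZA4_times (2 * int (ncomponents D)) (Rbar D T)"
    and "iS D T = -1 \<Longrightarrow> in_ZA4_times (2 * (int (ncomponents D) - 1)) (Rbar D T)"
proof -
  have T': "T \<subseteq> nonvirtual" using T by (simp add: states_iff)
  let ?n = "ncurves D T + ncomponents D + card (nonvirtual - T)"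
  have i: "iS D T = (if even ?n then 1 else -1)"
    unfolding iS_parity[OF T'] by (simp add: minus_one_power_iff)
  then show "iS D T = 1 \<or> iS D T = -1" by simp
  note p = aS_alphaS_parity[of T]
  have ex: "4 dvd 2 * a - 2 * b" if "even (a - b)" for a b :: int
    using that by presburger
  show "in_ZA4_times (2 * int (ncomponents D)) (Rbar D T)" if "iS D T = 1"
    using that i p by (intro Rbar_in_ZA4_times ex) (auto split: if_splits)
  show "in_ZA4_times (2 * (int (ncomponents D) - 1)) (Rbar D T)" if "iS D T = -1"
    using that i p by (intro Rbar_in_ZA4_times ex) (auto split: if_splits)
qed

lemma finite_states: "finite (states D)"
  using finite_nonvirtual by (simp add: states_def nonvirtual_def)

text \<open>The exponent of \<open>h\<close> is 0 for sign 1 and 1 for sign -1, and no other sign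
  occurs.\<close>

lemma Rinv_eq: "Rinv D = [:psi D, phi D:]"
proof -
  let ?P = "{T \<in> states D. iS D T = 1}" and ?N = "{T \<in> states D. iS D T = -1}"
  let ?f = "\<lambda>T. [:Rbar D T:] * [:0, 1:] ^ nat ((1 - iS D T) div 2)"
  have const: "(\<Sum>T\<in>X. [:Rbar D T:]) = [:\<Sum>T\<in>X. Rbar D T:]" for X
    by (induction X rule: infinite_finite_induct) simp_all
  have sgn: "(-1 :: int fls poly) ^ n = [:(-1) ^ n:]" for n
    by (induction n) (simp_all add: one_pCons)
  have "states D = ?P \<union> ?N" using Rbar_state(1) by blast
  then have "sum ?f (states D) = sum ?f ?P + sum ?f ?N"
    using finite_states by (subst sum.union_disjoint[symmetric]) auto
  also have "sum ?f ?P = (\<Sum>T\<in>?P. [:Rbar D T:])" by (rule sum.cong) simp_all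
  also have "sum ?f ?N = (\<Sum>T\<in>?N. [:Rbar D T:]) * [:0, 1:]"
    unfolding sum_distrib_right by (rule sum.cong) simp_all
  finally show ?thesis
    unfolding Rinv_def phi_def psi_def const sgn by simp
qed

end

theorem theorem4p1:
  fixes D :: vsdiag and k :: nat
  assumes "wf_diag D"
    and "ncomponents D = k"
  shows "Rinv D = [:psi D, phi D:]
    \<and> in_ZA4_times (2 * (int k - 1)) (phi D)
    \<and> in_ZA4_times (2 * int k) (psi D)"
proof -
  interpret planar_diagram D
    using assms(1) by unfold_locales (simp_all add: wf_diag_def)
  have sign: "in_ZA4_times m ((-1) ^ n * f)" if "in_ZA4_times m f" for m n f
    using that in_ZA4_times_uminus[of m f] by (cases "even n") simp_all
  have "in_ZA4_times (2 * (int k - 1)) (phi D)" "in_ZA4_times (2 * int k) (psi D)"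
    unfolding phi_def psi_def assms(2)[symmetric]
    by (intro sign in_ZA4_times_sum Rbar_state; simp)+
  then show ?thesis using Rinv_eq by blast
qed

end
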